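(* Let $m \geq 262$ be an integer, let $G$ be an $n$-vertex graph of maximum degree $m$, and let $\mathcal{G} = \{G_1, \dots, G_n\}$ be a family of spanning subgraphs of $G$, each of minimum degree at least $7\sqrt{m \log m}$. If $\mathcal G$ contains a Hamiltonian transversal, then $\mathcal G$ contains at least $\left\lceil \frac{1}{60}\log m \right\rceil!$ distinct Hamiltonian transversals.
   Context: All graphs are finite and simple; $\log$ is the natural logarithm; $[n]=\{1,\dots,n\}$. The members of a family $\mathcal G=\{G_1,\dots,G_n\}$ of subgraphs of $G$ are indexed and not necessarily distinct. A $\mathcal G$-transversal is a pair $(T,\phi)$ where $T\subseteq E(G)$ and $\phi:T\to[n]$ is a bijection with $e\in E(G_{\phi(e)})$ for every $e\in T$. It is Hamiltonian if $T$ is the edge set of a Hamiltonian cycle on $V(G)$. Transversals are distinct if they are distinct as pairs. "$\mathcal G$ contains a transversal" means that a $\mathcal G$-transversal exists. *)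

theory Defs
  imports Complex_Main "HOL-Library.FuncSet"
begin

record 'a sgraph =
  verts :: "'a set"
  edges :: "'a set set"

definition simple_graph :: "'a sgraph \<Rightarrow> bool" where
  "simple_graph G \<longleftrightarrow> finite (verts G) \<and> (\<forall>e\<in>edges G. e \<subseteq> verts G \<and> card e = 2)"

definition degree :: "'a sgraph \<Rightarrow> 'a \<Rightarrow> nat" where
  "degree G v = card {e \<in> edges G. v \<in> e}"

(* Max and Min carry no information when there are no vertices, but the graph without
   vertices has no Hamiltonian cycle. *)

definition max_degree :: "'a sgraph \<Rightarrow> nat" where
  "max_degree G = Max (degree G ` verts G)"

definition min_degree :: "'a sgraph \<Rightarrow> nat" where
  "min_degree G = Min (degree G ` verts G)"

definition spanning_subgraph :: "'a sgraph \<Rightarrow> 'a sgraph \<Rightarrow> bool" where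
  "spanning_subgraph H G \<longleftrightarrow> verts H = verts G \<and> edges H \<subseteq> edges G"

definition hamiltonian_cycle_edges :: "'a set \<Rightarrow> 'a set set \<Rightarrow> bool" where
  "hamiltonian_cycle_edges V T \<longleftrightarrow>
    (\<exists>vs. distinct vs \<and> set vs = V \<and> length vs \<ge> 3 \<and>
      T = {{vs ! i, vs ! (Suc i mod length vs)} | i. i < length vs})"

(* A bijection T -> [n] is a total HOL function that is undefined outside T (extensional),
   so that distinct HOL pairs (T, \<phi>) are exactly distinct transversals. *)

definition transversal ::
  "'a sgraph \<Rightarrow> nat \<Rightarrow> (nat \<Rightarrow> 'a sgraph) \<Rightarrow> 'a set set \<times> ('a set \<Rightarrow> nat) \<Rightarrow> bool" where
  "transversal G n F = (\<lambda>(T, \<phi>).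
    T \<subseteq> edges G \<and> \<phi> \<in> extensional T \<and> bij_betw \<phi> T {1..n} \<and>
    (\<forall>e\<in>T. e \<in> edges (F (\<phi> e))))"

definition hamiltonian_transversal ::
  "'a sgraph \<Rightarrow> nat \<Rightarrow> (nat \<Rightarrow> 'a sgraph) \<Rightarrow> 'a set set \<times> ('a set \<Rightarrow> nat) \<Rightarrow> bool" where
  "hamiltonian_transversal G n F p \<longleftrightarrow>
    transversal G n F p \<and> hamiltonian_cycle_edges (verts G) (fst p)"

end

theory Submission
  imports Defs
begin

text \<open>
  Let \<open>v\<^sub>0, v\<^sub>1, \<dots>\<close> be the given Hamiltonian cycle and \<open>c\<^sub>i\<close> the colour of its edge from \<open>v\<^sub>i\<close> to the
  next vertex. Choose a set \<open>A\<close> of vertices, no two of them consecutive, and detach the cycle at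
  \<open>A\<close>. What remains are \<open>|A|\<close> segments, each with two loose coloured ends. Such a \<^emph>\<open>stub\<close> has a
  vertex \<open>w\<close> and a colour \<open>c\<close>, and it can be attached to every \<open>a \<in> A\<close> with \<open>{a, w}\<close> an edge of
  the graph of colour \<open>c\<close>. Attaching two stubs to every element of \<open>A\<close> so that a single cycle
  arises gives a Hamiltonian transversal again, as every colour is still used exactly once.

  If every stub has at least \<open>d\<close> admissible elements of \<open>A\<close>, there are at least \<open>d!\<close> such
  attachments (\<open>fact_le_card_ham_maps\<close>). The source of new ones is Thomason's lollipop argument:
  if every stub has exactly two admissible elements, the number of single cycles that use one
  prescribed attachment is even (\<open>even_ham_maps\<close>). It follows that some stub \<open>t\<close> has the property
  that each of its admissible elements is used in some single cycle (\<open>saturated_stub\<close>). For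
  otherwise leave to every stub only its element in the given cycle and one element that it never
  uses: the given cycle would be the only one left, and one is odd. Now fix one of the \<open>d\<close>
  attachments of \<open>t\<close>, in a cycle that uses it, and contract the vertex \<open>a\<close> in question together
  with its two stubs. This merges two segments into one and removes \<open>a\<close> from \<open>A\<close>, so that every
  remaining stub keeps at least \<open>d - 1\<close> admissible elements; induction gives \<open>d \<cdot> (d - 1)!\<close>.

  It remains to find \<open>A\<close> such that every stub has at least \<open>k = \<lceil>log m / 60\<rceil>\<close> admissible elements
  (\<open>descents_dominate\<close>). Give a bit to every position of the cycle and let \<open>A\<close> be the positions
  whose bit is 1 while the next bit is 0; then no two elements of \<open>A\<close> are consecutive, whatever
  the bits are. Inside every neighbourhood select \<open>k\<close> disjoint groups of \<open>g\<close> positions,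
  pairwise not adjacent on the cycle. A group misses \<open>A\<close> with probability \<open>(3/4)\<^sup>g\<close>, and each bit
  influences at most \<open>4mk\<close> groups, so for \<open>g\<close> of the order of \<open>log m\<close> some choice of the bits lets
  every group meet \<open>A\<close>. In place of the Lovasz Local Lemma the proof counts, revealing the bits
  one at a time, how many assignments are still good (\<open>local_counting\<close>). The minimum degree
  enters as \<open>3kg \<le> 7 \<surd>(m log m)\<close>, valid for \<open>log m > 60\<close>; for \<open>log m \<le> 60\<close> the factorial is 1.
\<close>

section \<open>Single cycles formed by a pairing and a two-to-one map\<close>

text \<open>
  Think of \<open>S\<close> as the set of ends of the segments, and of \<open>\<sigma>\<close> as the map from one end of a
  segment to its other end.
\<close>

definition pairing :: "('s \<Rightarrow> 's) \<Rightarrow> 's set \<Rightarrow> bool" where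
  "pairing \<sigma> S \<longleftrightarrow> (\<forall>x\<in>S. \<sigma> x \<in> S \<and> \<sigma> x \<noteq> x \<and> \<sigma> (\<sigma> x) = x)"

text \<open>
  An attachment of the stubs in \<open>S\<close> to the vertices in \<open>A\<close>, two at each vertex.
\<close>

definition two_to_one :: "('s \<Rightarrow> 'b) \<Rightarrow> 's set \<Rightarrow> 'b set \<Rightarrow> bool" where
  "two_to_one f S A \<longleftrightarrow> f ` S \<subseteq> A \<and> (\<forall>a\<in>A. card {s \<in> S. f s = a} = 2)"

text \<open>
  The segments, given by \<open>\<sigma>\<close>, and the fibres of \<open>f\<close> form a multigraph on \<open>S\<close>. For a pairing \<open>\<sigma>\<close> and a
  two-to-one \<open>f\<close> it is 2-regular, hence a disjoint union of cycles, and it is one cycle iff it is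
  connected. Connectivity is expressed by closed sets, which avoids choosing an orientation or a
  starting point, so that different maps \<open>f\<close> are different cycles.
\<close>

definition single_cycle :: "('s \<Rightarrow> 's) \<Rightarrow> 's set \<Rightarrow> ('s \<Rightarrow> 'b) \<Rightarrow> bool" where
  "single_cycle \<sigma> S f \<longleftrightarrow>
    (\<forall>X\<subseteq>S. X \<noteq> {} \<longrightarrow> (\<forall>x\<in>X. \<sigma> x \<in> X) \<longrightarrow> (\<forall>x\<in>X. \<forall>y\<in>S. f y = f x \<longrightarrow> y \<in> X) \<longrightarrow> X = S)"

text \<open>
  For a fibre \<open>{t, u}\<close>, this is the pairing after the segments ending in \<open>t\<close> and \<open>u\<close> have been
  glued into one segment from \<open>\<sigma> t\<close> to \<open>\<sigma> u\<close>; it is meant for arguments in \<open>S - {t, u}\<close>.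
\<close>

definition contract :: "('s \<Rightarrow> 's) \<Rightarrow> 's \<Rightarrow> 's \<Rightarrow> 's \<Rightarrow> 's" where
  "contract \<sigma> t u x = (if x = \<sigma> t then \<sigma> u else if x = \<sigma> u then \<sigma> t else \<sigma> x)"

lemma single_cycleD:
  assumes "single_cycle \<sigma> S f" "X \<subseteq> S" "X \<noteq> {}" "\<And>x. x \<in> X \<Longrightarrow> \<sigma> x \<in> X"
    "\<And>x y. x \<in> X \<Longrightarrow> y \<in> S \<Longrightarrow> f y = f x \<Longrightarrow> y \<in> X"
  shows "X = S"
  using assms(1)[unfolded single_cycle_def, rule_format, OF assms(2,3)] assms(4,5) by blast

lemma single_cycle_cong:
  assumes "\<And>s. s \<in> S \<Longrightarrow> f s = g s"
  shows "single_cycle \<sigma> S f \<longleftrightarrow> single_cycle \<sigma> S g"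
proof -
  have "(\<forall>x\<in>X. \<forall>y\<in>S. f y = f x \<longrightarrow> y \<in> X) \<longleftrightarrow> (\<forall>x\<in>X. \<forall>y\<in>S. g y = g x \<longrightarrow> y \<in> X)"
    if "X \<subseteq> S" for X
  proof (intro ball_cong refl)
    fix x y assume "x \<in> X" "y \<in> S"
    then show "(f y = f x \<longrightarrow> y \<in> X) \<longleftrightarrow> (g y = g x \<longrightarrow> y \<in> X)"
      using assms[of x] assms[of y] that by auto
  qed
  then show ?thesis unfolding single_cycle_def by (simp cong: imp_cong)
qed

lemma two_to_one_cong:
  assumes "\<And>s. s \<in> S \<Longrightarrow> f s = g s"
  shows "two_to_one f S A \<longleftrightarrow> two_to_one g S A"
proof -
  have "{s \<in> S. f s = a} = {s \<in> S. g s = a}" for a using assms by auto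
  moreover have "f ` S = g ` S" using assms by simp
  ultimately show ?thesis unfolding two_to_one_def by simp
qed

lemma fibre_partner:
  assumes "two_to_one f S A" "t \<in> S"
  shows "\<exists>u. u \<in> S \<and> t \<noteq> u \<and> f u = f t \<and> (\<forall>y\<in>S. f y = f t \<longleftrightarrow> y = t \<or> y = u)"
proof -
  let ?X = "{s \<in> S. f s = f t}"
  have "card ?X = 2" using assms by (auto simp: two_to_one_def)
  then have "card (?X - {t}) = 1" using assms(2) by simp
  then obtain u where u: "?X - {t} = {u}" by (auto simp: card_1_singleton_iff)
  then have "u \<in> ?X - {t}" by simp
  moreover have "y = t \<or> y = u" if "y \<in> S" "f y = f t" for y
  proof -
    have "y \<in> insert t (?X - {t})" using that by blast
    then show ?thesis unfolding u by simp
  qed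
  ultimately show ?thesis by auto
qed

lemma fibre_two:
  assumes "two_to_one f S A" "a \<in> A"
  shows "\<exists>t u. t \<in> S \<and> u \<in> S \<and> t \<noteq> u \<and> f t = a \<and> f u = a \<and>
    (\<forall>y\<in>S. f y = a \<longleftrightarrow> y = t \<or> y = u)"
proof -
  have "card {s \<in> S. f s = a} = 2" using assms by (auto simp: two_to_one_def)
  then have "{s \<in> S. f s = a} \<noteq> {}" by force
  then obtain t where "t \<in> S" "f t = a" by blast
  then show ?thesis using fibre_partner[OF assms(1) \<open>t \<in> S\<close>] by blast
qed

lemma fibre_third:
  assumes "two_to_one f S A" "t \<in> S" "u \<in> S" "y \<in> S" "t \<noteq> u" "f u = f t" "f y = f t"
  shows "y = t \<or> y = u"
proof -
  obtain v where v: "\<forall>y\<in>S. f y = f t \<longleftrightarrow> y = t \<or> y = v"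
    using fibre_partner[OF assms(1,2)] by meson
  show ?thesis using bspec[OF v assms(3)] bspec[OF v assms(4)] assms(5-) by simp
qed

lemma pairing_contract:
  assumes "pairing \<sigma> S" "t \<in> S" "u \<in> S" "t \<noteq> u" "\<sigma> t \<noteq> u"
  shows "pairing (contract \<sigma> t u) (S - {t, u})"
  unfolding pairing_def
proof
  fix x assume "x \<in> S - {t, u}"
  then have x: "x \<in> S" "x \<noteq> t" "x \<noteq> u" by auto
  note p = assms(1)[unfolded pairing_def, rule_format]
  note pt = p[OF assms(2)] and pu = p[OF assms(3)] and px = p[OF x(1)]
  have ne: "\<sigma> u \<noteq> t" "\<sigma> u \<noteq> \<sigma> t" using pt pu assms(4,5) by metis+
  consider "x = \<sigma> t" | "x = \<sigma> u" | "x \<noteq> \<sigma> t" "x \<noteq> \<sigma> u" by blast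
  then show "contract \<sigma> t u x \<in> S - {t, u} \<and> contract \<sigma> t u x \<noteq> x \<and>
    contract \<sigma> t u (contract \<sigma> t u x) = x"
  proof cases
    case 1 then show ?thesis using pu ne by (simp add: contract_def)
  next
    case 2 then show ?thesis using pt ne assms(5) by (simp add: contract_def)
  next
    case 3
    then have "\<sigma> x \<noteq> t" "\<sigma> x \<noteq> u" using px by auto
    moreover have "\<sigma> x \<noteq> \<sigma> t" "\<sigma> x \<noteq> \<sigma> u" using px pt pu x by metis+
    ultimately show ?thesis using 3 px by (simp add: contract_def)
  qed
qed

lemma two_to_one_contract:
  assumes "two_to_one f S A" "t \<in> S" "u \<in> S" "t \<noteq> u" "f u = f t"
  shows "two_to_one f (S - {t, u}) (A - {f t})"
  unfolding two_to_one_def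
proof (intro conjI ballI)
  show "f ` (S - {t, u}) \<subseteq> A - {f t}"
    using assms fibre_third[OF assms(1-3) _ assms(4,5)] by (auto simp: two_to_one_def)
next
  fix a assume "a \<in> A - {f t}"
  moreover from this have "{s \<in> S - {t, u}. f s = a} = {s \<in> S. f s = a}" using assms(5) by auto
  ultimately show "card {s \<in> S - {t, u}. f s = a} = 2" using assms(1) by (auto simp: two_to_one_def)
qed

text \<open>
  A closed set for one of the two structures yields one for the other by adding or removing \<open>t\<close> and
  \<open>u\<close>: closed sets of the first structure contain both or neither of them, according to whether
  they contain \<open>\<sigma> t\<close> and \<open>\<sigma> u\<close>.
\<close>

lemma single_cycle_contract:
  assumes pair: "pairing \<sigma> S" and S: "t \<in> S" "u \<in> S" and ne: "t \<noteq> u" "\<sigma> t \<noteq> u"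
    and fib: "\<And>y. y \<in> S \<Longrightarrow> f y = f t \<longleftrightarrow> y = t \<or> y = u"
  shows "single_cycle \<sigma> S f \<longleftrightarrow> single_cycle (contract \<sigma> t u) (S - {t, u}) f"
proof
  note p = pair[unfolded pairing_def, rule_format]
  have st: "\<sigma> t \<in> S" "\<sigma> t \<noteq> t" "\<sigma> t \<noteq> u" and su: "\<sigma> u \<in> S" "\<sigma> u \<noteq> u" "\<sigma> u \<noteq> t"
    using p S ne by metis+
  have fut: "f u = f t" using fib S by blast
  have stt: "\<sigma> (\<sigma> t) = t" "\<sigma> (\<sigma> u) = u" using p S by auto
  have inv: "x = \<sigma> t" if "x \<in> S" "\<sigma> x = t" for x using p that by metis
  have inv': "x = \<sigma> u" if "x \<in> S" "\<sigma> x = u" for x using p that by metis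
  {
    assume sc: "single_cycle \<sigma> S f"
    show "single_cycle (contract \<sigma> t u) (S - {t, u}) f"
      unfolding single_cycle_def
    proof (intro allI impI)
      fix X assume X: "X \<subseteq> S - {t, u}" "X \<noteq> {}" and cl: "\<forall>x\<in>X. contract \<sigma> t u x \<in> X"
        and clf: "\<forall>x\<in>X. \<forall>y\<in>S - {t, u}. f y = f x \<longrightarrow> y \<in> X"
      define Y where "Y = X \<union> (if \<sigma> t \<in> X then {t, u} else {})"
      have tu: "\<sigma> t \<in> X \<longleftrightarrow> \<sigma> u \<in> X" using cl unfolding contract_def by (metis)
      have "Y = S"
      proof (rule single_cycleD[OF sc])
        show "Y \<subseteq> S" using X S by (auto simp: Y_def)
        show "Y \<noteq> {}" using X by (auto simp: Y_def)
        show "\<sigma> x \<in> Y" if "x \<in> Y" for x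
        proof (cases "x \<in> X")
          case True
          then have c: "contract \<sigma> t u x \<in> X" "x \<in> S" using cl X by auto
          consider "x = \<sigma> t" | "x = \<sigma> u" | "x \<noteq> \<sigma> t" "x \<noteq> \<sigma> u" by blast
          then show ?thesis
          proof cases
            case 1 then show ?thesis using True stt(1) by (simp add: Y_def)
          next
            case 2 then show ?thesis using True tu stt(2) by (simp add: Y_def)
          next
            case 3 then show ?thesis using c(1) by (simp add: Y_def contract_def)
          qed
        next
          case False
          then have "\<sigma> t \<in> X" "x = t \<or> x = u" using that unfolding Y_def by (auto split: if_splits)
          then show ?thesis using tu unfolding Y_def by blast
        qed
        show "y \<in> Y" if "x \<in> Y" "y \<in> S" "f y = f x" for x y
        proof (cases "x \<in> X")
          case True
          then have "x \<in> S" "x \<noteq> t" "x \<noteq> u" using X by auto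
          then have "f x \<noteq> f t" using fib by blast
          then have "y \<in> S - {t, u}" using that fut by auto
          then have "y \<in> X" using True clf that(3) by blast
          then show ?thesis unfolding Y_def by blast
        next
          case False
          then have *: "\<sigma> t \<in> X" "x = t \<or> x = u" using that unfolding Y_def by (auto split: if_splits)
          then have "f y = f t" using that(3) fut by auto
          then have "y = t \<or> y = u" using fib[OF that(2)] by simp
          then show ?thesis using * by (auto simp: Y_def)
        qed
      qed
      then show "X = S - {t, u}" using X unfolding Y_def by (auto split: if_splits)
    qed
  next
    assume sc: "single_cycle (contract \<sigma> t u) (S - {t, u}) f"
    show "single_cycle \<sigma> S f"
      unfolding single_cycle_def
    proof (intro allI impI)
      fix X assume X: "X \<subseteq> S" "X \<noteq> {}" and cl: "\<forall>x\<in>X. \<sigma> x \<in> X"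
        and clf: "\<forall>x\<in>X. \<forall>y\<in>S. f y = f x \<longrightarrow> y \<in> X"
      have tu: "t \<in> X \<longleftrightarrow> u \<in> X" using clf S fut by metis
      have tX: "t \<in> X \<longleftrightarrow> \<sigma> t \<in> X" "u \<in> X \<longleftrightarrow> \<sigma> u \<in> X" using cl stt by metis+
      have "X - {t, u} = S - {t, u}"
      proof (rule single_cycleD[OF sc])
        show "X - {t, u} \<subseteq> S - {t, u}" using X by auto
        show "X - {t, u} \<noteq> {}" using X tu tX st by blast
        show "contract \<sigma> t u x \<in> X - {t, u}" if "x \<in> X - {t, u}" for x
        proof -
          have x: "x \<in> X" "x \<in> S" "x \<noteq> t" "x \<noteq> u" using that X by auto
          consider "x = \<sigma> t" | "x = \<sigma> u" | "x \<noteq> \<sigma> t" "x \<noteq> \<sigma> u" by blast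
          then show ?thesis
          proof cases
            case 1 then show ?thesis using x tX tu su by (simp add: contract_def)
          next
            case 2 then show ?thesis using x tX tu st by (auto simp: contract_def)
          next
            case 3
            then have "\<sigma> x \<noteq> t" "\<sigma> x \<noteq> u" using inv inv' x by blast+
            then show ?thesis using 3 x cl by (simp add: contract_def)
          qed
        qed
        show "y \<in> X - {t, u}" if "x \<in> X - {t, u}" "y \<in> S - {t, u}" "f y = f x" for x y
          using that clf by auto
      qed
      then show "X = S" using st tX tu X by blast
    qed
  }
qed

text \<open>
  Otherwise \<open>{t, u}\<close> would be a component that misses \<open>v\<close>. This is what makes contraction
  possible.
\<close>

lemma fibre_not_paired:
  assumes "pairing \<sigma> S" "single_cycle \<sigma> S f" "t \<in> S" "u \<in> S"
    and "\<And>y. y \<in> S \<Longrightarrow> f y = f t \<longleftrightarrow> y = t \<or> y = u"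
    and "v \<in> S" "f v \<noteq> f t"
  shows "\<sigma> t \<noteq> u"
proof
  assume "\<sigma> t = u"
  then have "\<sigma> u = t" using assms by (auto simp: pairing_def)
  have "{t, u} = S"
  proof (rule single_cycleD[OF assms(2)])
    show "\<sigma> x \<in> {t, u}" if "x \<in> {t, u}" for x
      using that \<open>\<sigma> t = u\<close> \<open>\<sigma> u = t\<close> by auto
    have "f u = f t" using assms(4) assms(5)[of u] by simp
    then show "y \<in> {t, u}" if "x \<in> {t, u}" "y \<in> S" "f y = f x" for x y
      using that assms(5)[OF that(2)] by auto
  qed (use assms(3,4) in auto)
  then show False using assms(6,7) assms(5)[OF assms(6)] by blast
qed

text \<open>
  Cut a cycle at the two vertices \<open>f e\<close> and \<open>f p\<close>. Two paths remain, and of the two ways other than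
  the original one to reconnect their four ends, exactly one gives a single cycle. All other fibres
  can be contracted, so only the case of four stubs has to be inspected.
\<close>

lemma switch_exactly_one:
  assumes "finite A" "two_to_one f S A" "pairing \<sigma> S" "single_cycle \<sigma> S f"
    and "r \<in> S" "e \<in> S" "r \<noteq> e" "f r = f e"
    and "p \<in> S" "q \<in> S" "p \<noteq> q" "f p = f q" "f p \<noteq> f e"
  shows "single_cycle \<sigma> S (f(e := f p, p := f e)) \<longleftrightarrow> \<not> single_cycle \<sigma> S (f(e := f q, q := f e))"
  using assms
proof (induction "card A" arbitrary: A S \<sigma> rule: less_induct)
  case less
  note tto = less.prems(2) and pair = less.prems(3) and sc = less.prems(4) and S = less.prems(5-)
  show ?case
  proof (cases "A \<subseteq> {f e, f p}")
    case True
    \<comment> \<open>Only the four stubs are left, and \<open>\<sigma> r\<close> is one of \<open>p\<close> and \<open>q\<close>.\<close>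
    have fr: "y \<in> {r, e, p, q}" if "y \<in> S" for y
    proof -
      have "f y = f e \<or> f y = f p" using True that tto by (auto simp: two_to_one_def)
      then show ?thesis
        using fibre_third[OF tto S(1,2) that] fibre_third[OF tto S(5,6) that] S by auto
    qed
    have dist: "r \<noteq> p" "r \<noteq> q" "e \<noteq> p" "e \<noteq> q" using S by metis+
    have Seq: "S = {r, e, p, q}" using fr S by blast
    have fe: "y = r \<or> y = e" if "y \<in> S" "f y = f e" for y
      using fibre_third[OF tto S(1,2) that(1)] S that by auto
    have "\<sigma> r \<noteq> e"
      using fibre_not_paired[OF pair sc S(1,2), of p] S fe by metis
    moreover have "\<sigma> r \<in> S" "\<sigma> r \<noteq> r" using pair S(1) by (auto simp: pairing_def)
    ultimately consider "\<sigma> r = p" | "\<sigma> r = q" using Seq by auto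
    then show ?thesis
    proof cases
      case 1
      have \<sigma>: "\<sigma> p = r" "\<sigma> e = q" "\<sigma> q = e"
        using pair 1 Seq S dist unfolding pairing_def by (metis insertE singletonD)+
      have "\<not> single_cycle \<sigma> S (f(e := f p, p := f e))"
      proof
        assume "single_cycle \<sigma> S (f(e := f p, p := f e))"
        then have "{r, p} = S"
          by (rule single_cycleD) (use Seq \<sigma> 1 S dist in auto)
        then show False using S dist by auto
      qed
      moreover have "single_cycle \<sigma> S (f(e := f q, q := f e))"
        unfolding single_cycle_def
      proof (intro allI impI)
        fix X assume X: "X \<subseteq> S" "X \<noteq> {}" and cl: "\<forall>x\<in>X. \<sigma> x \<in> X"
          and clf: "\<forall>x\<in>X. \<forall>y\<in>S. (f(e := f q, q := f e)) y = (f(e := f q, q := f e)) x \<longrightarrow> y \<in> X"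
        have "r \<in> X \<longleftrightarrow> q \<in> X" "e \<in> X \<longleftrightarrow> p \<in> X"
          using clf S dist by (smt (verit) fun_upd_apply)+
        moreover have "r \<in> X \<longleftrightarrow> p \<in> X" "e \<in> X \<longleftrightarrow> q \<in> X" using cl \<sigma> 1 by metis+
        ultimately show "X = S" using X Seq by blast
      qed
      ultimately show ?thesis by simp
    next
      case 2
      have \<sigma>: "\<sigma> q = r" "\<sigma> e = p" "\<sigma> p = e"
        using pair 2 Seq S dist unfolding pairing_def by (metis insertE singletonD)+
      have "\<not> single_cycle \<sigma> S (f(e := f q, q := f e))"
      proof
        assume "single_cycle \<sigma> S (f(e := f q, q := f e))"
        then have "{r, q} = S"
          by (rule single_cycleD) (use Seq \<sigma> 2 S dist in auto)
        then show False using S dist by auto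
      qed
      moreover have "single_cycle \<sigma> S (f(e := f p, p := f e))"
        unfolding single_cycle_def
      proof (intro allI impI)
        fix X assume X: "X \<subseteq> S" "X \<noteq> {}" and cl: "\<forall>x\<in>X. \<sigma> x \<in> X"
          and clf: "\<forall>x\<in>X. \<forall>y\<in>S. (f(e := f p, p := f e)) y = (f(e := f p, p := f e)) x \<longrightarrow> y \<in> X"
        have "r \<in> X \<longleftrightarrow> p \<in> X" "e \<in> X \<longleftrightarrow> q \<in> X"
          using clf S dist by (smt (verit) fun_upd_apply)+
        moreover have "r \<in> X \<longleftrightarrow> q \<in> X" "e \<in> X \<longleftrightarrow> p \<in> X" using cl \<sigma> 2 by metis+
        ultimately show "X = S" using X Seq by blast
      qed
      ultimately show ?thesis by simp
    qed
  next
    case False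
    then obtain b where b: "b \<in> A" "b \<noteq> f e" "b \<noteq> f p" by auto
    obtain t u where tu: "t \<in> S" "u \<in> S" "t \<noteq> u" "f t = b" "f u = b"
      "\<forall>y\<in>S. f y = b \<longleftrightarrow> y = t \<or> y = u"
      using fibre_two[OF tto b(1)] by (elim exE conjE) (rule that)
    have fb: "f e \<noteq> b" "f r \<noteq> b" "f p \<noteq> b" "f q \<noteq> b"
      using b(2,3) S(4,8) by simp_all
    have neq: "t \<noteq> r" "t \<noteq> e" "t \<noteq> p" "t \<noteq> q" "u \<noteq> r" "u \<noteq> e" "u \<noteq> p" "u \<noteq> q"
      using fb tu(4,5) by blast+
    have fib: "g y = g t \<longleftrightarrow> y = t \<or> y = u" if "y \<in> S"
      "g t = b" "\<And>y. y \<in> {r, e, p, q} \<Longrightarrow> g y \<noteq> b" "\<And>y. y \<notin> {r, e, p, q} \<Longrightarrow> g y = f y" for g y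
      using that tu(6) neq by (cases "y \<in> {r, e, p, q}") auto
    have \<sigma>t: "\<sigma> t \<noteq> u"
      by (rule fibre_not_paired[OF pair sc tu(1,2), of e]) (use fib[of _ f] fb S(2) tu(4) in auto)
    note con = single_cycle_contract[OF pair tu(1,2,3) \<sigma>t]
    have "single_cycle (contract \<sigma> t u) (S - {t, u}) (f(e := f p, p := f e)) \<longleftrightarrow>
      \<not> single_cycle (contract \<sigma> t u) (S - {t, u}) (f(e := f q, q := f e))"
    proof (rule less.hyps[of "A - {b}"])
      show "card (A - {b}) < card A" by (rule card_Diff1_less[OF less.prems(1) b(1)])
      show "two_to_one f (S - {t, u}) (A - {b})"
        using two_to_one_contract[OF tto tu(1-3)] tu by simp
      show "pairing (contract \<sigma> t u) (S - {t, u})"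
        by (rule pairing_contract[OF pair tu(1-3) \<sigma>t])
      show "single_cycle (contract \<sigma> t u) (S - {t, u}) f"
        using con[of f, OF fib] sc fb tu(4) by auto
    qed (use less.prems(1) S neq in auto)
    moreover have "single_cycle \<sigma> S (f(e := f p, p := f e)) \<longleftrightarrow>
      single_cycle (contract \<sigma> t u) (S - {t, u}) (f(e := f p, p := f e))"
      by (intro con fib) (use neq fb tu(4) in \<open>auto split: if_splits\<close>)
    moreover have "single_cycle \<sigma> S (f(e := f q, q := f e)) \<longleftrightarrow>
      single_cycle (contract \<sigma> t u) (S - {t, u}) (f(e := f q, q := f e))"
      by (intro con fib) (use neq fb tu(4) in \<open>auto split: if_splits\<close>)
    ultimately show ?thesis by simp
  qed
qed

section \<open>An even number of single cycles\<close>

text \<open>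
  The handshake lemma: the degrees add up to the number of ordered adjacent pairs, which is even
  as no vertex is adjacent to itself.
\<close>

lemma even_card_odd_degree:
  assumes "finite V" and sym: "\<And>v w. v \<in> V \<Longrightarrow> w \<in> V \<Longrightarrow> R v w \<Longrightarrow> R w v"
    and irr: "\<And>v. v \<in> V \<Longrightarrow> \<not> R v v"
  shows "even (card {v \<in> V. odd (card {w \<in> V. R v w})})"
proof -
  have "even (\<Sum>v\<in>V. card {w \<in> V. R v w})"
    using assms
  proof (induction V rule: finite_induct)
    case empty
    then show ?case by simp
  next
    case (insert x V)
    have 1: "card {w \<in> insert x V. R v w} = card {w \<in> V. R v w} + (if R v x then 1 else 0)" for v
    proof (cases "R v x")
      case True
      then have "{w \<in> insert x V. R v w} = insert x {w \<in> V. R v w}" by auto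
      then show ?thesis using True insert.hyps by simp
    next
      case False
      then have "{w \<in> insert x V. R v w} = {w \<in> V. R v w}" by auto
      then show ?thesis using False by simp
    qed
    have "(\<Sum>v\<in>V. if R v x then 1 else 0) = card {v \<in> V. R v x}"
      using insert.hyps by (simp add: sum.If_cases Int_def)
    also have "{v \<in> V. R v x} = {v \<in> V. R x v}" using insert.prems(1) by blast
    finally have "(\<Sum>v\<in>insert x V. card {w \<in> insert x V. R v w}) =
      2 * card {v \<in> V. R x v} + (\<Sum>v\<in>V. card {w \<in> V. R v w})"
      unfolding 1 using insert.hyps insert.prems(2)[of x] by (simp add: sum.distrib)
    moreover have "even (\<Sum>v\<in>V. card {w \<in> V. R v w})"
      using insert.IH insert.prems by blast
    ultimately show ?case by simp
  qed
  then show ?thesis using assms(1) by (simp add: even_sum_iff)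
qed

lemma two_to_one_swap:
  assumes "two_to_one f S A" "e \<in> S" "q \<in> S"
  shows "two_to_one (f(e := f q, q := f e)) S A"
proof -
  define \<tau> where "\<tau> = id(e := q, q := e)"
  have \<tau>: "\<tau> (\<tau> x) = x" "x \<in> S \<Longrightarrow> \<tau> x \<in> S" for x using assms by (auto simp: \<tau>_def)
  have f: "f(e := f q, q := f e) = f \<circ> \<tau>" by (auto simp: \<tau>_def)
  have "{s \<in> S. (f \<circ> \<tau>) s = a} = \<tau> ` {s \<in> S. f s = a}" for a
  proof (intro subset_antisym subsetI)
    fix x assume "x \<in> {s \<in> S. (f \<circ> \<tau>) s = a}"
    then show "x \<in> \<tau> ` {s \<in> S. f s = a}" using \<tau> by (intro image_eqI[of _ _ "\<tau> x"]) auto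
  qed (use \<tau> in auto)
  moreover have "inj_on \<tau> X" for X by (rule inj_on_inverseI[of _ \<tau>]) (rule \<tau>)
  ultimately have "card {s \<in> S. (f \<circ> \<tau>) s = a} = card {s \<in> S. f s = a}" for a
    by (simp add: card_image)
  moreover have "(f \<circ> \<tau>) ` S \<subseteq> A" using assms(1) \<tau> by (auto simp: two_to_one_def)
  ultimately show ?thesis using assms(1) unfolding f two_to_one_def by simp
qed

text \<open>
  \<open>N s\<close> is the set of vertices to which the stub \<open>s\<close> may be attached. The maps are extensional, so
  that they can be counted.
\<close>

definition ham_maps :: "('s \<Rightarrow> 's) \<Rightarrow> 's set \<Rightarrow> 'b set \<Rightarrow> ('s \<Rightarrow> 'b set) \<Rightarrow> ('s \<Rightarrow> 'b) set" where
  "ham_maps \<sigma> S A N =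
    {f \<in> S \<rightarrow>\<^sub>E A. two_to_one f S A \<and> single_cycle \<sigma> S f \<and> (\<forall>s\<in>S. f s \<in> N s)}"

lemma finite_ham_maps: "finite S \<Longrightarrow> finite A \<Longrightarrow> finite (ham_maps \<sigma> S A N)"
  unfolding ham_maps_def by (rule finite_subset[of _ "S \<rightarrow>\<^sub>E A"]) (auto intro: finite_PiE)

text \<open>
  The lollipop argument. Fix the attachment of \<open>r\<close> to \<open>a\<close> and cut the cycle at \<open>a\<close>: what remains is a
  Hamiltonian path that starts in \<open>a\<close> with \<open>r\<close> and ends with the other stub at \<open>a\<close>, the loose one.
  Forget whether that stub may really be attached to \<open>a\<close>. Attaching it to an admissible vertex
  \<open>b \<noteq> a\<close> and detaching one of the two stubs at \<open>b\<close> gives another such path, for exactly one choice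
  of the latter. This defines a graph on the paths, where the degree of a path is the number of
  admissible vertices of its loose stub other than \<open>a\<close>: 1 if the path closes to an admissible cycle
  and 2 if not. By the handshake lemma there is an even number of paths that close.
\<close>

lemma even_ham_maps:
  assumes fin: "finite S" "finite A" and pair: "pairing \<sigma> S" and r: "r \<in> S" "a \<in> N r"
    and N: "\<And>s. s \<in> S \<Longrightarrow> N s \<subseteq> A" "\<And>s. s \<in> S \<Longrightarrow> card (N s) = 2"
  shows "even (card {f \<in> ham_maps \<sigma> S A N. f r = a})"
proof -
  define V where "V = {f \<in> S \<rightarrow>\<^sub>E A. two_to_one f S A \<and> single_cycle \<sigma> S f \<and> f r = a \<and>
    (\<forall>s\<in>S. f s \<noteq> a \<longrightarrow> f s \<in> N s)}"
  define loose where "loose f = (SOME e. e \<in> S \<and> r \<noteq> e \<and> (\<forall>y\<in>S. f y = a \<longleftrightarrow> y = r \<or> y = e))" for f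
  define R where "R f f' \<longleftrightarrow> (\<exists>q\<in>S. f q \<noteq> a \<and> f q \<in> N (loose f) \<and>
    f' = f(loose f := f q, q := a) \<and> single_cycle \<sigma> S f')" for f f'
  have finV: "finite V" unfolding V_def
    by (rule finite_subset[of _ "S \<rightarrow>\<^sub>E A"]) (use fin in \<open>auto intro: finite_PiE\<close>)
  have loose: "loose f \<in> S" "r \<noteq> loose f" "f (loose f) = a"
    "\<And>y. y \<in> S \<Longrightarrow> f y = a \<Longrightarrow> y = r \<or> y = loose f" if "f \<in> V" for f
  proof -
    have "two_to_one f S A" "f r = a" using that by (auto simp: V_def)
    then have "\<exists>e. e \<in> S \<and> r \<noteq> e \<and> (\<forall>y\<in>S. f y = a \<longleftrightarrow> y = r \<or> y = e)"
      using fibre_partner[of f S A r] r(1) by meson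
    then have "loose f \<in> S \<and> r \<noteq> loose f \<and> (\<forall>y\<in>S. f y = a \<longleftrightarrow> y = r \<or> y = loose f)"
      unfolding loose_def by (rule someI_ex)
    then show "loose f \<in> S" "r \<noteq> loose f" "f (loose f) = a"
      "\<And>y. y \<in> S \<Longrightarrow> f y = a \<Longrightarrow> y = r \<or> y = loose f" by blast+
  qed
  \<comment> \<open>The rotation is reversed by attaching the stub that came loose to its former vertex, which is
      admissible for it since it was not loose before.\<close>
  have sym: "R f' f" if ff: "f \<in> V" "f' \<in> V" "R f f'" for f f'
  proof -
    obtain q where q: "q \<in> S" "f q \<noteq> a" "f q \<in> N (loose f)" "f' = f(loose f := f q, q := a)"
      using ff(3) by (auto simp: R_def)
    note e = loose[OF that(1)]
    have qe: "q \<noteq> loose f" "q \<noteq> r" using q(2) e that(1) by (auto simp: V_def)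
    have "loose f' = q" using loose(4)[OF that(2) q(1)] q(4) qe(2) by simp
    moreover have "f q \<in> N q" using that(1) q(1,2) by (auto simp: V_def)
    moreover have "f = f'(q := f q, loose f := a)" using q(4) qe e by (auto simp: fun_eq_iff)
    moreover have "single_cycle \<sigma> S f" using that(1) by (simp add: V_def)
    ultimately show ?thesis
      unfolding R_def using q e(1) qe by (intro bexI[of _ "loose f"]) auto
  qed
  have irr: "\<not> R f f" if "f \<in> V" for f
  proof
    assume "R f f"
    then obtain q where q: "q \<in> S" "f q \<noteq> a" "f = f(loose f := f q, q := a)"
      by (auto simp: R_def)
    then have "f q = a" by (metis fun_upd_same)
    then show False using q by simp
  qed
  \<comment> \<open>A rotation is determined by the new vertex of the loose stub; the lemma on switches supplies
      and makes unique the stub that has to give way.\<close>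
  have deg: "card {f' \<in> V. R f f'} = card (N (loose f) - {a})" if f: "f \<in> V" for f
  proof -
    let ?e = "loose f"
    note e = loose[OF f]
    have fV: "f \<in> S \<rightarrow>\<^sub>E A" "two_to_one f S A" "single_cycle \<sigma> S f" "f r = a"
      "\<And>s. s \<in> S \<Longrightarrow> f s \<noteq> a \<Longrightarrow> f s \<in> N s"
      using f by (auto simp: V_def)
    have sw: "single_cycle \<sigma> S (f(?e := f p, p := a)) \<longleftrightarrow> \<not> single_cycle \<sigma> S (f(?e := f q, q := a))"
      if "p \<in> S" "q \<in> S" "p \<noteq> q" "f p = f q" "f p \<noteq> a" for p q
      using switch_exactly_one[OF fin(2) fV(2) pair fV(3) r(1) e(1,2), of p q] e(3) fV(4) that by simp
    have "bij_betw (\<lambda>f'. f' ?e) {f' \<in> V. R f f'} (N ?e - {a})"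
      unfolding bij_betw_def
    proof
      show "inj_on (\<lambda>f'. f' ?e) {f' \<in> V. R f f'}"
      proof (rule inj_onI)
        fix f1 f2 assume f12: "f1 \<in> {f' \<in> V. R f f'}" "f2 \<in> {f' \<in> V. R f f'}" "f1 ?e = f2 ?e"
        obtain p where p: "p \<in> S" "f p \<noteq> a" "f1 = f(?e := f p, p := a)" "single_cycle \<sigma> S f1"
          using f12(1) by (auto simp: R_def)
        obtain q where q: "q \<in> S" "f q \<noteq> a" "f2 = f(?e := f q, q := a)" "single_cycle \<sigma> S f2"
          using f12(2) by (auto simp: R_def)
        have "?e \<noteq> p" "?e \<noteq> q" using p(2) q(2) e(3) by auto
        then have "f p = f q" using f12(3) p(3) q(3) by simp
        then have "p = q" using sw[OF p(1) q(1)] p q by auto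
        then show "f1 = f2" using p q by simp
      qed
      show "(\<lambda>f'. f' ?e) ` {f' \<in> V. R f f'} = N ?e - {a}"
      proof (intro subset_antisym subsetI)
        fix b assume "b \<in> (\<lambda>f'. f' ?e) ` {f' \<in> V. R f f'}"
        then obtain f' where f': "R f f'" "b = f' ?e" by auto
        then obtain q where q: "f q \<noteq> a" "f q \<in> N ?e" "f' = f(?e := f q, q := a)"
          by (auto simp: R_def)
        then have "?e \<noteq> q" using e(3) by auto
        then show "b \<in> N ?e - {a}" using q f'(2) by simp
      next
        fix b assume b: "b \<in> N ?e - {a}"
        then have "b \<in> A" using N(1)[OF e(1)] by auto
        from fibre_two[OF fV(2) this] obtain p q where pq: "p \<in> S" "q \<in> S" "p \<noteq> q" "f p = b" "f q = b"
          by blast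
        have "f p \<noteq> a" using b pq by simp
        then have "\<exists>x\<in>S. f x = b \<and> single_cycle \<sigma> S (f(?e := f x, x := a))"
          using sw[OF pq(1-3)] pq by auto
        then obtain x where x: "x \<in> S" "f x = b" "single_cycle \<sigma> S (f(?e := f x, x := a))" by blast
        let ?f = "f(?e := f x, x := a)"
        have ne: "?e \<noteq> x" "r \<noteq> x" using x(2) b e(3) fV(4) by auto
        have "?f \<in> V"
          unfolding V_def
        proof (intro CollectI conjI ballI impI)
          show "?f \<in> S \<rightarrow>\<^sub>E A" using fV(1) x(1) e(1) \<open>b \<in> A\<close> x(2) e(3)
            by (auto simp: PiE_def extensional_def)
          show "two_to_one ?f S A" using two_to_one_swap[OF fV(2) e(1) x(1)] e(3) by simp
          show "?f r = a" using ne fV(4) e(2) by simp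
          show "?f s \<in> N s" if "s \<in> S" "?f s \<noteq> a" for s
            using that b x(2) fV(5)[of s] by (auto split: if_splits)
        qed (rule x(3))
        moreover have "R f ?f" unfolding R_def using x b by (intro bexI[of _ x]) auto
        moreover have "?f ?e = b" using ne x(2) by simp
        ultimately show "b \<in> (\<lambda>f'. f' ?e) ` {f' \<in> V. R f f'}" by (intro image_eqI[of _ _ ?f]) auto
      qed
    qed
    then show ?thesis by (rule bij_betw_same_card)
  qed
  have odd: "odd (card {f' \<in> V. R f f'}) \<longleftrightarrow> a \<in> N (loose f)" if f: "f \<in> V" for f
  proof -
    have "card (N (loose f)) = 2" using N(2) loose(1)[OF f] by simp
    then show ?thesis unfolding deg[OF f] by (cases "a \<in> N (loose f)") simp_all
  qed
  have "{f \<in> V. odd (card {f' \<in> V. R f f'})} = {f \<in> ham_maps \<sigma> S A N. f r = a}"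
  proof (intro subset_antisym subsetI)
    fix f assume "f \<in> {f \<in> V. odd (card {f' \<in> V. R f f'})}"
    then have f: "f \<in> V" "a \<in> N (loose f)" using odd by auto
    have "f s \<in> N s" if "s \<in> S" for s
    proof (cases "f s = a")
      case True
      then have "s = r \<or> s = loose f" using loose(4)[OF f(1) that] by simp
      then show ?thesis using True f(2) r(2) by auto
    next
      case False
      then show ?thesis using f(1) that by (auto simp: V_def)
    qed
    then show "f \<in> {f \<in> ham_maps \<sigma> S A N. f r = a}" using f(1) by (auto simp: V_def ham_maps_def)
  next
    fix f assume f: "f \<in> {f \<in> ham_maps \<sigma> S A N. f r = a}"
    then have fV: "f \<in> V" by (auto simp: V_def ham_maps_def)
    have "f (loose f) \<in> N (loose f)" using f loose(1)[OF fV] by (auto simp: ham_maps_def)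
    then have "a \<in> N (loose f)" using loose(3)[OF fV] by simp
    then show "f \<in> {f \<in> V. odd (card {f' \<in> V. R f f'})}" using odd[OF fV] fV by simp
  qed
  then show ?thesis using even_card_odd_degree[of V R, OF finV sym irr] by simp
qed

text \<open>
  If every stub \<open>t\<close> had an admissible vertex \<open>u t\<close> that no admissible cycle uses, restrict every
  stub to \<open>u t\<close> and its vertex in \<open>f0\<close>. Then \<open>f0\<close> is the only admissible cycle left, contradicting
  the parity.
\<close>

lemma saturated_stub:
  assumes fin: "finite S" "finite A" and pair: "pairing \<sigma> S" and "S \<noteq> {}"
    and N: "\<And>s. s \<in> S \<Longrightarrow> N s \<subseteq> A" and f0: "f0 \<in> ham_maps \<sigma> S A N"
  shows "\<exists>t\<in>S. \<forall>b\<in>N t. \<exists>f\<in>ham_maps \<sigma> S A N. f t = b"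
proof (rule ccontr)
  assume "\<not> ?thesis"
  then have "\<forall>t\<in>S. \<exists>b. b \<in> N t \<and> (\<forall>f\<in>ham_maps \<sigma> S A N. f t \<noteq> b)" by blast
  then obtain u where u: "\<And>t. t \<in> S \<Longrightarrow> u t \<in> N t"
    "\<And>t f. t \<in> S \<Longrightarrow> f \<in> ham_maps \<sigma> S A N \<Longrightarrow> f t \<noteq> u t" by metis
  define M where "M s = {f0 s, u s}" for s
  have f0N: "f0 s \<in> N s" if "s \<in> S" for s using f0 that by (auto simp: ham_maps_def)
  have MN: "M s \<subseteq> N s" if "s \<in> S" for s using f0N u(1) that by (auto simp: M_def)
  have sub: "ham_maps \<sigma> S A M \<subseteq> ham_maps \<sigma> S A N" using MN by (auto simp: ham_maps_def)
  obtain r where r: "r \<in> S" using \<open>S \<noteq> {}\<close> by auto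
  have "{f \<in> ham_maps \<sigma> S A M. f r = f0 r} = {f0}"
  proof (intro subset_antisym subsetI)
    fix f assume "f \<in> {f \<in> ham_maps \<sigma> S A M. f r = f0 r}"
    then have f: "f \<in> ham_maps \<sigma> S A M" by simp
    have "f s = f0 s" for s
    proof (cases "s \<in> S")
      case True
      then have "f s \<in> M s" "f s \<noteq> u s" using f u(2) sub by (auto simp: ham_maps_def)
      then show ?thesis by (simp add: M_def)
    next
      case False
      then show ?thesis using f f0 by (auto simp: ham_maps_def PiE_def extensional_def)
    qed
    then show "f \<in> {f0}" by auto
  next
    fix f assume "f \<in> {f0}"
    then show "f \<in> {f \<in> ham_maps \<sigma> S A M. f r = f0 r}" using f0 by (auto simp: ham_maps_def M_def)
  qed
  moreover have "even (card {f \<in> ham_maps \<sigma> S A M. f r = f0 r})"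
  proof (rule even_ham_maps[OF fin pair r])
    show "f0 r \<in> M r" by (simp add: M_def)
    fix s assume s: "s \<in> S"
    show "M s \<subseteq> A" using MN[OF s] N[OF s] by blast
    show "card (M s) = 2" using u(2)[OF s f0] by (simp add: M_def)
  qed
  ultimately show False by simp
qed

section \<open>Factorially many single cycles\<close>

lemma two_to_one_extend:
  assumes "two_to_one g (S - {t, u}) (A - {b})" "t \<in> S" "u \<in> S" "t \<noteq> u" "b \<in> A"
  shows "two_to_one (g(t := b, u := b)) S A"
  unfolding two_to_one_def
proof (intro conjI ballI)
  let ?h = "g(t := b, u := b)"
  have g: "g ` (S - {t, u}) \<subseteq> A - {b}" using assms(1) by (auto simp: two_to_one_def)
  then show "?h ` S \<subseteq> A" using assms(5) by auto
  fix a assume a: "a \<in> A"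
  show "card {s \<in> S. ?h s = a} = 2"
  proof (cases "a = b")
    case True
    have "{s \<in> S. ?h s = b} = {t, u}" using g assms by auto
    then show ?thesis using True assms(4) by simp
  next
    case False
    then have "{s \<in> S. ?h s = a} = {s \<in> S - {t, u}. g s = a}" by auto
    then show ?thesis using assms(1) a False by (auto simp: two_to_one_def)
  qed
qed

text \<open>
  For a saturated stub \<open>t\<close>, each of its at least \<open>d\<close> admissible vertices \<open>b\<close> occurs in some cycle.
  Contracting the fibre of \<open>b\<close> in this cycle leaves a structure without the vertex \<open>b\<close>, whose cycles
  extend to cycles that attach \<open>t\<close> to \<open>b\<close>. Different vertices \<open>b\<close> yield different cycles, so the
  count is multiplied by \<open>d\<close> in passing from \<open>d - 1\<close> to \<open>d\<close>.
\<close>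

theorem fact_le_card_ham_maps:
  assumes "finite S" "finite A" "A \<noteq> {}" "pairing \<sigma> S" "ham_maps \<sigma> S A N \<noteq> {}"
    and "\<And>s. s \<in> S \<Longrightarrow> N s \<subseteq> A" "\<And>s. s \<in> S \<Longrightarrow> d \<le> card (N s)"
  shows "fact d \<le> card (ham_maps \<sigma> S A N)"
  using assms
proof (induction d arbitrary: S A \<sigma> N)
  case 0
  then have "card (ham_maps \<sigma> S A N) \<noteq> 0" using finite_ham_maps[OF 0(1,2)] by simp
  then show ?case by simp
next
  case (Suc d)
  note fin = Suc.prems(1,2) and pair = Suc.prems(4) and N = Suc.prems(6,7)
  let ?H = "ham_maps \<sigma> S A N"
  have finH: "finite ?H" using finite_ham_maps[OF fin] .
  obtain f0 where f0: "f0 \<in> ?H" using Suc.prems(5) by auto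
  show ?case
  proof (cases "d = 0")
    case True
    have "card ?H \<noteq> 0" using finH f0 by auto
    then show ?thesis using True by simp
  next
    case False
    obtain a0 where "a0 \<in> A" using Suc.prems(3) by auto
    have "S \<noteq> {}" using fibre_two[of f0 S A a0] f0 \<open>a0 \<in> A\<close> by (auto simp: ham_maps_def)
    obtain t where t: "t \<in> S" "\<And>b. b \<in> N t \<Longrightarrow> \<exists>f\<in>?H. f t = b"
      using saturated_stub[OF fin pair \<open>S \<noteq> {}\<close> N(1) f0] by blast
    have key: "fact d \<le> card {f \<in> ?H. f t = b}" if b: "b \<in> N t" for b
    proof -
      obtain f where f: "f \<in> ?H" "f t = b" using t(2)[OF b] by auto
      then have ff: "two_to_one f S A" "single_cycle \<sigma> S f" "\<And>s. s \<in> S \<Longrightarrow> f s \<in> N s"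
        by (auto simp: ham_maps_def)
      have bA: "b \<in> A" using b N(1) t(1) by auto
      obtain u where u: "u \<in> S" "t \<noteq> u" "f u = b" "\<And>y. y \<in> S \<Longrightarrow> f y = b \<Longrightarrow> y = t \<or> y = u"
        using fibre_partner[OF ff(1) t(1)] f(2) by blast
      \<comment> \<open>A second vertex guarantees that the two stubs at \<open>b\<close> belong to different segments.\<close>
      have "\<not> N t \<subseteq> {b}"
      proof
        assume "N t \<subseteq> {b}"
        then have "card (N t) \<le> 1" using card_mono[of "{b}" "N t"] by simp
        then show False using N(2)[OF t(1)] False by simp
      qed
      then obtain b' where b': "b' \<in> A - {b}" using N(1)[OF t(1)] by blast
      then obtain v where v: "v \<in> S" "f v = b'" using fibre_two[OF ff(1), of b'] by blast
      have \<sigma>t: "\<sigma> t \<noteq> u"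
        by (rule fibre_not_paired[OF pair ff(2) t(1) u(1) _ v(1)])
          (use f(2) u v b' in auto)
      let ?S = "S - {t, u}" and ?A = "A - {b}" and ?\<sigma> = "contract \<sigma> t u" and ?N = "\<lambda>s. N s - {b}"
      let ?H' = "ham_maps ?\<sigma> ?S ?A ?N"
      have IH: "fact d \<le> card ?H'"
      proof (rule Suc.IH)
        show "finite ?S" "finite ?A" using fin by auto
        show "?A \<noteq> {}" using b' by blast
        show "pairing ?\<sigma> ?S" by (rule pairing_contract[OF pair t(1) u(1,2) \<sigma>t])
        show "N s - {b} \<subseteq> ?A" if "s \<in> ?S" for s using N(1) that by auto
        show "d \<le> card (N s - {b})" if "s \<in> ?S" for s
        proof -
          have "Suc d \<le> card (N s)" using N(2) that by simp
          also have "\<dots> \<le> Suc (card (N s - {b}))" by (auto simp: card_Diff_singleton_if)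
          finally show ?thesis by simp
        qed
        let ?f = "restrict f ?S"
        have "two_to_one f ?S ?A" using two_to_one_contract[OF ff(1) t(1) u(1,2)] u(3) f(2) by simp
        then have 1: "two_to_one ?f ?S ?A" using two_to_one_cong[of ?S ?f f ?A] by simp
        have "single_cycle ?\<sigma> ?S f"
          using single_cycle_contract[OF pair t(1) u(1,2) \<sigma>t, of f] ff(2) u f(2) by auto
        then have 2: "single_cycle ?\<sigma> ?S ?f" using single_cycle_cong[of ?S ?f f] by simp
        have "?f \<in> ?S \<rightarrow>\<^sub>E ?A" using 1 by (auto simp: two_to_one_def)
        moreover have "?f s \<in> N s - {b}" if "s \<in> ?S" for s using that ff(3) u(4) by auto
        ultimately have "?f \<in> ?H'" using 1 2 by (auto simp: ham_maps_def)
        then show "?H' \<noteq> {}" by blast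
      qed
      \<comment> \<open>Undo the contraction: put the vertex \<open>b\<close> back between \<open>t\<close> and \<open>u\<close>.\<close>
      let ?e = "\<lambda>g. g(t := b, u := b)"
      have "card ?H' \<le> card {f \<in> ?H. f t = b}"
      proof (rule card_inj_on_le[of ?e])
        show "finite {f \<in> ?H. f t = b}" using finH by simp
        show "inj_on ?e ?H'"
        proof (rule inj_onI)
          fix g g' assume g: "g \<in> ?H'" "g' \<in> ?H'" "?e g = ?e g'"
          show "g = g'"
          proof
            fix x show "g x = g' x"
            proof (cases "x \<in> {t, u}")
              case True
              then show ?thesis using g(1,2) by (auto simp: ham_maps_def PiE_def extensional_def)
            next
              case False
              then show ?thesis using fun_cong[OF g(3), of x] by auto
            qed
          qed
        qed
        show "?e ` ?H' \<subseteq> {f \<in> ?H. f t = b}"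
        proof
          fix h assume "h \<in> ?e ` ?H'"
          then obtain g where g: "g \<in> ?H'" "h = ?e g" by auto
          then have gg: "g \<in> ?S \<rightarrow>\<^sub>E ?A" "two_to_one g ?S ?A" "single_cycle ?\<sigma> ?S g" "\<And>s. s \<in> ?S \<Longrightarrow> g s \<in> N s - {b}"
            by (auto simp: ham_maps_def)
          have "h \<in> S \<rightarrow>\<^sub>E A" using gg(1) g(2) bA t(1) u(1) by (auto simp: PiE_def extensional_def Pi_def)
          moreover have "two_to_one h S A" using two_to_one_extend[OF gg(2) t(1) u(1,2) bA] g(2) by simp
          moreover have "single_cycle \<sigma> S h"
          proof -
            have "single_cycle ?\<sigma> ?S h" using gg(3) single_cycle_cong[of ?S h g ?\<sigma>] g(2) by auto
            moreover have "h y = h t \<longleftrightarrow> y = t \<or> y = u" if "y \<in> S" for y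
              using gg(4)[of y] that g(2) by auto
            ultimately show ?thesis using single_cycle_contract[OF pair t(1) u(1,2) \<sigma>t, of h] by blast
          qed
          moreover have "h s \<in> N s" if "s \<in> S" for s
            using that g(2) gg(4)[of s] b ff(3)[OF u(1)] u(3) by auto
          moreover have "h t = b" using g(2) by simp
          ultimately show "h \<in> {f \<in> ?H. f t = b}" by (auto simp: ham_maps_def)
        qed
      qed
      then show ?thesis using IH by linarith
    qed
    have finN: "finite (N t)" using N(1)[OF t(1)] fin(2) finite_subset by auto
    have "fact (Suc d) = Suc d * fact d" by simp
    also have "\<dots> \<le> card (N t) * fact d" using N(2)[OF t(1)] by (rule mult_right_mono) simp
    also have "\<dots> \<le> (\<Sum>b\<in>N t. card {f \<in> ?H. f t = b})"
      using sum_mono[of "N t" "\<lambda>_. fact d" "\<lambda>b. card {f \<in> ?H. f t = b}"] key by simp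
    also have "\<dots> = card (\<Union>b\<in>N t. {f \<in> ?H. f t = b})"
      by (rule card_UN_disjoint[symmetric]) (use finN finH in auto)
    also have "\<dots> \<le> card ?H" by (rule card_mono[OF finH]) auto
    finally show ?thesis .
  qed
qed

text \<open>
  Contract all fibres of \<open>f0\<close> outside \<open>A\<close>. The resulting pairing on the remaining stubs describes
  the segments into which the cycle \<open>f0\<close> falls when it is detached at \<open>A\<close>, and it serves for all maps
  that differ from \<open>f0\<close> only in how these stubs are attached to \<open>A\<close>.
\<close>

lemma collapse_fibres:
  assumes "finite V" "A \<subseteq> V" "A \<noteq> {}" "two_to_one f0 S V" "pairing \<sigma> S" "single_cycle \<sigma> S f0"
  shows "\<exists>\<sigma>'. pairing \<sigma>' {s \<in> S. f0 s \<in> A} \<and>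
    (\<forall>f. (\<forall>s\<in>S. if f0 s \<in> A then f s \<in> A else f s = f0 s) \<longrightarrow>
      (single_cycle \<sigma> S f \<longleftrightarrow> single_cycle \<sigma>' {s \<in> S. f0 s \<in> A} f))"
  using assms
proof (induction "card (V - A)" arbitrary: V S \<sigma> rule: less_induct)
  case less
  note tto = less.prems(4) and pair = less.prems(5) and sc = less.prems(6)
  show ?case
  proof (cases "V = A")
    case True
    then have "{s \<in> S. f0 s \<in> A} = S" using tto by (auto simp: two_to_one_def)
    then show ?thesis using pair by auto
  next
    case False
    then obtain b where b: "b \<in> V" "b \<notin> A" using less.prems(2) by auto
    obtain t u where tu: "t \<in> S" "u \<in> S" "t \<noteq> u" "f0 t = b" "f0 u = b"
      "\<forall>y\<in>S. f0 y = b \<longleftrightarrow> y = t \<or> y = u"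
      using fibre_two[OF tto b(1)] by (elim exE conjE) (rule that)
    obtain a where a: "a \<in> A" using less.prems(3) by auto
    then obtain v where v: "v \<in> S" "f0 v = a" using fibre_two[OF tto, of a] less.prems(2) by blast
    have fib: "f0 y = f0 t \<longleftrightarrow> y = t \<or> y = u" if "y \<in> S" for y
      using bspec[OF tu(6) that] unfolding tu(4) .
    have fv: "f0 v \<noteq> f0 t" using v(2) tu(4) a b(2) by auto
    have \<sigma>t: "\<sigma> t \<noteq> u"
      by (rule fibre_not_paired[OF pair sc tu(1,2) _ v(1) fv]) (rule fib)
    let ?S = "S - {t, u}" and ?\<sigma> = "contract \<sigma> t u"
    have S0: "{s \<in> ?S. f0 s \<in> A} = {s \<in> S. f0 s \<in> A}" using tu(4,5) b by auto
    have "\<exists>\<sigma>'. pairing \<sigma>' {s \<in> ?S. f0 s \<in> A} \<and>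
      (\<forall>f. (\<forall>s\<in>?S. if f0 s \<in> A then f s \<in> A else f s = f0 s) \<longrightarrow>
      (single_cycle ?\<sigma> ?S f \<longleftrightarrow> single_cycle \<sigma>' {s \<in> ?S. f0 s \<in> A} f))"
    proof (rule less.hyps[of "V - {b}"])
      have "V - {b} - A = V - A - {b}" by auto
      then show "card (V - {b} - A) < card (V - A)"
        using less.prems(1) b by (metis DiffI card_Diff1_less finite_Diff)
      show "two_to_one f0 ?S (V - {b})"
        using two_to_one_contract[OF tto tu(1-3)] tu(4,5) by simp
      show "pairing ?\<sigma> ?S" by (rule pairing_contract[OF pair tu(1-3) \<sigma>t])
      show "single_cycle ?\<sigma> ?S f0"
        using single_cycle_contract[OF pair tu(1-3) \<sigma>t, of f0, OF fib] sc by simp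
    qed (use less.prems(1-3) b in auto)
    then obtain \<sigma>' where \<sigma>': "pairing \<sigma>' {s \<in> S. f0 s \<in> A}"
      "\<And>f. (\<forall>s\<in>?S. if f0 s \<in> A then f s \<in> A else f s = f0 s) \<Longrightarrow>
      single_cycle ?\<sigma> ?S f \<longleftrightarrow> single_cycle \<sigma>' {s \<in> S. f0 s \<in> A} f"
      unfolding S0 by blast
    have "single_cycle \<sigma> S f \<longleftrightarrow> single_cycle \<sigma>' {s \<in> S. f0 s \<in> A} f"
      if f: "\<forall>s\<in>S. if f0 s \<in> A then f s \<in> A else f s = f0 s" for f
    proof -
      have ft: "f t = b" "f u = b" using bspec[OF f tu(1)] bspec[OF f tu(2)] tu(4,5) b by simp_all
      have "f y = f t \<longleftrightarrow> y = t \<or> y = u" if y: "y \<in> S" for y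
      proof (cases "f0 y \<in> A")
        case True
        then have "f y \<in> A" using bspec[OF f y] by simp
        then have "f y \<noteq> b" using b by auto
        then show ?thesis using ft by auto
      next
        case False
        then have "f y = f0 y" using bspec[OF f y] by simp
        then show ?thesis using ft(1) bspec[OF tu(6) y] by simp
      qed
      then show ?thesis
        using single_cycle_contract[OF pair tu(1-3) \<sigma>t, of f] \<sigma>'(2)[of f] f by auto
    qed
    then show ?thesis using \<sigma>'(1) by blast
  qed
qed

section \<open>Rainbow Hamiltonian cycles\<close>

text \<open>
  A single cycle can be traversed: \<open>xs\<close> lists the stub by which each segment is entered, and the
  vertices \<open>f x\<close> then follow one another. By induction on the number of vertices: traverse
  the contracted cycle and put the removed vertex back into the segment that it had been merged into.
\<close>

lemma single_cycle_list:
  assumes "finite A" "A \<noteq> {}" "two_to_one f S A" "pairing \<sigma> S" "single_cycle \<sigma> S f"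
  shows "\<exists>xs. xs \<noteq> [] \<and> distinct (map f xs) \<and> f ` set xs = A \<and> (\<forall>x\<in>S. x \<in> set xs \<longleftrightarrow> \<sigma> x \<notin> set xs)
    \<and> set xs \<subseteq> S \<and> (\<forall>i<length xs. f (\<sigma> (xs ! i)) = f (xs ! (Suc i mod length xs)))"
  using assms
proof (induction "card A" arbitrary: A S \<sigma> rule: less_induct)
  case less
  note tto = less.prems(3) and pair = less.prems(4) and sc = less.prems(5)
  note p = pair[unfolded pairing_def, rule_format]
  obtain b where b: "b \<in> A" using less.prems(2) by auto
  obtain t0 u0 where tu0: "t0 \<in> S" "u0 \<in> S" "t0 \<noteq> u0" "f t0 = b" "f u0 = b"
    "\<forall>y\<in>S. f y = b \<longleftrightarrow> y = t0 \<or> y = u0"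
    using fibre_two[OF tto b] by (elim exE conjE) (rule that)
  show ?case
  proof (cases "A = {b}")
    case True
    then have "\<forall>y\<in>S. f y = b" using tto by (auto simp: two_to_one_def)
    then have S: "S = {t0, u0}" using tu0 by auto
    then have "\<sigma> t0 = u0" "\<sigma> u0 = t0" using p[of t0] p[of u0] by auto
    then show ?thesis using S tu0 True by (intro exI[of _ "[t0]"]) auto
  next
    case False
    then obtain a where a: "a \<in> A" "a \<noteq> b" using b by auto
    then obtain v where v: "v \<in> S" "f v = a" using fibre_two[OF tto, of a] by blast
    have fib: "f y = f t0 \<longleftrightarrow> y = t0 \<or> y = u0" if "y \<in> S" for y
      using bspec[OF tu0(6) that] unfolding tu0(4) .
    have fv: "f v \<noteq> f t0" using v(2) tu0(4) a(2) by auto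
    have \<sigma>t0: "\<sigma> t0 \<noteq> u0"
      by (rule fibre_not_paired[OF pair sc tu0(1,2) _ v(1) fv]) (rule fib)
    let ?S = "S - {t0, u0}" and ?\<sigma> = "contract \<sigma> t0 u0"
    have pair': "pairing ?\<sigma> ?S" by (rule pairing_contract[OF pair tu0(1-3) \<sigma>t0])
    have "\<exists>xs. xs \<noteq> [] \<and> distinct (map f xs) \<and> f ` set xs = A - {b} \<and>
      (\<forall>x\<in>?S. x \<in> set xs \<longleftrightarrow> ?\<sigma> x \<notin> set xs)
    \<and> set xs \<subseteq> ?S \<and> (\<forall>i<length xs. f (?\<sigma> (xs ! i)) = f (xs ! (Suc i mod length xs)))"
    proof (rule less.hyps)
      show "card (A - {b}) < card A" by (rule card_Diff1_less[OF less.prems(1) b])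
      show "two_to_one f ?S (A - {b})"
        using two_to_one_contract[OF tto tu0(1-3)] tu0(4,5) by simp
      show "single_cycle ?\<sigma> ?S f"
        using single_cycle_contract[OF pair tu0(1-3) \<sigma>t0, of f, OF fib] sc by simp
    qed (use less.prems(1) a pair' in auto)
    then obtain xs where xs: "xs \<noteq> []" "distinct (map f xs)" "f ` set xs = A - {b}"
      "\<forall>x\<in>?S. x \<in> set xs \<longleftrightarrow> ?\<sigma> x \<notin> set xs" "set xs \<subseteq> ?S"
      "\<forall>i<length xs. f (?\<sigma> (xs ! i)) = f (xs ! (Suc i mod length xs))"
      by (elim exE conjE) (rule that)
    note alt = bspec[OF xs(4)] and cyc = xs(6)[rule_format]
    have "\<sigma> t0 \<in> ?S" using p[OF tu0(1)] \<sigma>t0 by auto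
    moreover have "?\<sigma> (\<sigma> t0) = \<sigma> u0" by (simp add: contract_def)
    ultimately have "\<sigma> t0 \<in> set xs \<or> \<sigma> u0 \<in> set xs" using alt[of "\<sigma> t0"] by simp
    \<comment> \<open>The merged segment is traversed in one of its two directions; let \<open>t\<close> be the stub of the
        removed vertex that is met first.\<close>
    then obtain t u where tu: "{t, u} = {t0, u0}" "\<sigma> t \<in> set xs" by blast
    have tuS: "t \<in> S" "u \<in> S" "t \<noteq> u" "f t = b" "f u = b" and tne: "\<sigma> t \<noteq> u"
      using tu(1) tu0 \<sigma>t0 p by (auto simp: doubleton_eq_iff)
    note pt = p[OF tuS(1)] and pu = p[OF tuS(2)]
    have une: "\<sigma> u \<noteq> t" "\<sigma> u \<noteq> \<sigma> t" using pt pu tne tuS(3) by metis+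
    have c: "?\<sigma> (\<sigma> t) = \<sigma> u" "?\<sigma> (\<sigma> u) = \<sigma> t" "\<And>x. x \<noteq> \<sigma> t \<Longrightarrow> x \<noteq> \<sigma> u \<Longrightarrow> ?\<sigma> x = \<sigma> x"
      using tu(1) une by (auto simp: contract_def doubleton_eq_iff)
    have S': "?S = S - {t, u}" using tu(1) by simp
    have \<sigma>u: "\<sigma> u \<notin> set xs" using alt[of "\<sigma> t"] c(1) tu(2) pt tne unfolding S' by simp
    have tux: "t \<notin> set xs" "u \<notin> set xs" using xs(5) unfolding S' by auto
    let ?n = "length xs"
    obtain k where k: "k < ?n" "xs ! k = \<sigma> t" using tu(2) by (auto simp: in_set_conv_nth)
    \<comment> \<open>Start the traversal after the merged segment, which makes it the last one; then the
        removed vertex, entered through \<open>u\<close>, can be appended.\<close>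
    define ys where "ys = rotate (Suc k) xs"
    have "distinct (map f ys)"
      unfolding ys_def rotate_map[symmetric] distinct_rotate by (rule xs(2))
    then have ys: "set ys = set xs" "length ys = ?n" "distinct (map f ys)"
      by (simp_all add: ys_def)
    have nth: "ys ! i = xs ! ((Suc k + i) mod ?n)" if "i < ?n" for i
      unfolding ys_def by (rule nth_rotate[OF that])
    have n: "0 < ?n" using xs(1) by simp
    have step: "f (?\<sigma> (ys ! i)) = f (ys ! (Suc i mod ?n))" if "i < ?n" for i
    proof -
      have "f (?\<sigma> (ys ! i)) = f (xs ! (Suc ((Suc k + i) mod ?n) mod ?n))"
        using nth[OF that] cyc[of "(Suc k + i) mod ?n"] n by simp
      also have "Suc ((Suc k + i) mod ?n) mod ?n = (Suc k + Suc i mod ?n) mod ?n"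
        by (simp only: mod_Suc_eq mod_add_right_eq add_Suc_right)
      also have "xs ! ((Suc k + Suc i mod ?n) mod ?n) = ys ! (Suc i mod ?n)"
        using n by (simp add: nth)
      finally show ?thesis .
    qed
    have last: "ys ! (?n - 1) = \<sigma> t"
    proof -
      have "Suc k + (?n - 1) = k + ?n" using n by simp
      then have "(Suc k + (?n - 1)) mod ?n = k" using k(1) by (simp only: mod_add_self2 mod_less)
      then show ?thesis using nth[of "?n - 1"] n k(2) by simp
    qed
    let ?zs = "ys @ [u]"
    have "f (\<sigma> (?zs ! i)) = f (?zs ! (Suc i mod length ?zs))" if i: "i < length ?zs" for i
    proof -
      consider "Suc i < ?n" | "Suc i = ?n" | "i = ?n" using i ys(2) by fastforce
      then show ?thesis
      proof cases
        case 1
        then have "i < length ys" using ys(2) by linarith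
        have "ys ! i \<noteq> ys ! (?n - 1)"
          using ys(2,3) 1 nth_eq_iff_index_eq[of ys i "?n - 1"] by (auto simp: distinct_map)
        then have "ys ! i \<noteq> \<sigma> t" "ys ! i \<noteq> \<sigma> u"
          using last \<sigma>u nth_mem[of i ys] \<open>i < length ys\<close> unfolding ys(1) by auto
        then have "f (\<sigma> (ys ! i)) = f (ys ! Suc i)" using step[of i] c(3)[of "ys ! i"] 1 by simp
        then show ?thesis using 1 ys(2) by (simp add: nth_append)
      next
        case 2
        then have "?zs ! i = \<sigma> t" "?zs ! (Suc i mod length ?zs) = u"
          using last 2[symmetric] ys(2) by (simp_all add: nth_append)
        then show ?thesis using pt tuS(4,5) by simp
      next
        case 3
        have "f (?\<sigma> (ys ! (?n - 1))) = f (ys ! 0)" using step[of "?n - 1"] n by simp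
        then have "f (\<sigma> u) = f (ys ! 0)" using last c(1) by simp
        then show ?thesis using 3 ys(2) n by (simp add: nth_append)
      qed
    qed
    moreover have "x \<in> set ?zs \<longleftrightarrow> \<sigma> x \<notin> set ?zs" if x: "x \<in> S" for x
    proof -
      consider "x = t" | "x = u" | "x = \<sigma> t" | "x = \<sigma> u" | "x \<notin> {t, u, \<sigma> t, \<sigma> u}" by blast
      then show ?thesis
      proof cases
        case 5
        then have "?\<sigma> x = \<sigma> x" using c(3) by simp
        moreover have "\<sigma> x \<noteq> u" using 5 p[OF x] by auto
        ultimately show ?thesis using 5 alt[of x] x S' ys(1) by auto
      qed (use tu(2) tux \<sigma>u pt pu tuS une tne ys(1) in auto)
    qed
    moreover have "distinct (map f ?zs)" using ys(1,3) xs(3) tuS(5) by auto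
    moreover have "f ` set ?zs = A" using ys(1) xs(3) tuS(5) b by auto
    moreover have "set ?zs \<subseteq> S" using ys(1) xs(5) tuS by auto
    ultimately show ?thesis by (intro exI[of _ ?zs]) auto
  qed
qed

lemma Suc_mod_eq: "i < n \<Longrightarrow> Suc i mod n = (if Suc i = n then 0 else Suc i)"
  by auto

lemma inj_on_Suc_mod: "inj_on (\<lambda>i. Suc i mod n) {..<n}"
  by (rule inj_onI) (auto simp: Suc_mod_eq split: if_splits)

text \<open>
  The edges of a cycle are distinct because its length is at least 3: for length 2 the two edges
  coincide.
\<close>

lemma inj_on_cycle_edges:
  assumes "distinct vs" "3 \<le> length vs"
  shows "inj_on (\<lambda>i. {vs ! i, vs ! (Suc i mod length vs)}) {..<length vs}"
proof (rule inj_onI)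
  let ?n = "length vs"
  fix i j assume ij: "i \<in> {..<?n}" "j \<in> {..<?n}"
    "{vs ! i, vs ! (Suc i mod ?n)} = {vs ! j, vs ! (Suc j mod ?n)}"
  have lt: "Suc i mod ?n < ?n" "Suc j mod ?n < ?n" using assms(2) by (auto intro!: mod_less_divisor)
  have "i = j \<or> (i = Suc j mod ?n \<and> Suc i mod ?n = j)"
    using ij lt nth_eq_iff_index_eq[OF assms(1)] by (auto simp: doubleton_eq_iff)
  then show "i = j" using ij(1,2) assms(2) by (auto simp: Suc_mod_eq split: if_splits)
qed

text \<open>
  The pair \<open>(i, b)\<close> denotes a half of the edge at position \<open>i\<close> of a cycle: the half at its first
  vertex for \<open>b = False\<close> and the one at its second vertex for \<open>b = True\<close>. These half-edges are the
  stubs of the cycle when it is detached at all of its vertices.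
\<close>

definition end_of :: "'a list \<Rightarrow> nat \<times> bool \<Rightarrow> 'a" where
  "end_of vs = (\<lambda>(i, b). vs ! (if b then Suc i mod length vs else i))"

definition flip :: "nat \<times> bool \<Rightarrow> nat \<times> bool" where
  "flip = (\<lambda>(i, b). (i, \<not> b))"

lemma pairing_flip: "pairing flip ({..<n} \<times> UNIV)"
  by (auto simp: pairing_def flip_def)

lemma two_to_one_end_of:
  assumes "distinct vs" "2 \<le> length vs"
  shows "two_to_one (end_of vs) ({..<length vs} \<times> UNIV) (set vs)"
  unfolding two_to_one_def
proof (intro conjI ballI)
  let ?n = "length vs"
  have lt: "Suc i mod ?n < ?n" for i using assms(2) by (intro mod_less_divisor) linarith
  then show "end_of vs ` ({..<?n} \<times> UNIV) \<subseteq> set vs" by (auto simp: end_of_def)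
  fix a assume "a \<in> set vs"
  then obtain j where j: "j < ?n" "vs ! j = a" by (auto simp: in_set_conv_nth)
  let ?p = "if j = 0 then ?n - 1 else j - 1"
  have p: "?p < ?n" "Suc ?p mod ?n = j" using j(1) assms(2) by auto
  have eq: "vs ! i = a \<longleftrightarrow> i = j" if "i < ?n" for i
    using nth_eq_iff_index_eq[OF assms(1) that j(1)] j(2) by simp
  have "{s \<in> {..<?n} \<times> UNIV. end_of vs s = a} = {(j, False), (?p, True)}"
  proof (intro subset_antisym subsetI)
    fix s assume s: "s \<in> {s \<in> {..<?n} \<times> UNIV. end_of vs s = a}"
    obtain i b where ib: "s = (i, b)" by fastforce
    show "s \<in> {(j, False), (?p, True)}"
    proof (cases b)
      case True
      then have "Suc i mod ?n = Suc ?p mod ?n" using s ib eq[OF lt] p(2) by (auto simp: end_of_def)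
      then have "i = ?p" using inj_on_Suc_mod[of ?n] s ib p(1) by (auto simp: inj_on_def)
      then show ?thesis using ib True by simp
    next
      case False
      then show ?thesis using s ib eq by (auto simp: end_of_def)
    qed
  next
    fix s assume "s \<in> {(j, False), (?p, True)}"
    then consider "s = (j, False)" | "s = (?p, True)" by blast
    then show "s \<in> {s \<in> {..<?n} \<times> UNIV. end_of vs s = a}"
      by cases (use j p in \<open>simp_all add: end_of_def\<close>)
  qed
  then show "card {s \<in> {..<?n} \<times> UNIV. end_of vs s = a} = 2" by simp
qed

lemma single_cycle_end_of:
  assumes "2 \<le> length vs"
  shows "single_cycle flip ({..<length vs} \<times> UNIV) (end_of vs)"
  unfolding single_cycle_def
proof (intro allI impI)
  let ?n = "length vs"
  fix X assume X: "X \<subseteq> {..<?n} \<times> UNIV" "X \<noteq> {}" and fl: "\<forall>x\<in>X. flip x \<in> X"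
    and cl: "\<forall>x\<in>X. \<forall>y\<in>{..<?n} \<times> UNIV. end_of vs y = end_of vs x \<longrightarrow> y \<in> X"
  have both: "(i, b) \<in> X" if "(i, b') \<in> X" for i b b'
    using that fl[rule_format, OF that] by (cases b; cases b') (simp_all add: flip_def)
  have lt: "Suc i mod ?n < ?n" for i using assms by (intro mod_less_divisor) linarith
  have next_in: "(Suc i mod ?n, b) \<in> X" if "(i, b') \<in> X" for i b b'
  proof -
    have "(i, True) \<in> X" using both that by blast
    moreover have "end_of vs (Suc i mod ?n, False) = end_of vs (i, True)" by (simp add: end_of_def)
    ultimately have "(Suc i mod ?n, False) \<in> X" using cl lt by blast
    then show ?thesis by (rule both)
  qed
  obtain i0 b0 where i0: "(i0, b0) \<in> X" using X(2) by fastforce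
  have "((i0 + d) mod ?n, b) \<in> X" for d b
  proof (induction d arbitrary: b)
    case 0
    have "i0 < ?n" using i0 X(1) by auto
    then show ?case using both[OF i0] by simp
  next
    case (Suc d)
    have "(Suc ((i0 + d) mod ?n) mod ?n, b) \<in> X" using next_in[OF Suc] .
    then show ?case by (simp add: mod_Suc_eq)
  qed
  note all = this
  have "(i, b) \<in> X" if "i < ?n" for i b
  proof -
    have "i0 < ?n" using i0 X(1) by auto
    then have "(i0 + (?n - i0 + i)) mod ?n = i" using that by simp
    then show ?thesis using all[of "?n - i0 + i" b] by simp
  qed
  then show "X = {..<?n} \<times> UNIV" using X(1) by auto
qed

text \<open>
  Every edge is a segment with ends \<open>(i, False)\<close> and \<open>(i, True)\<close>, so a traversal of the single cycle
  meets every edge exactly once and lists its two end vertices consecutively.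
\<close>

lemma hamiltonian_cycle_of_single_cycle:
  assumes "finite V" "card V = n" "3 \<le> n" "two_to_one f ({..<n} \<times> UNIV) V"
    and "single_cycle flip ({..<n} \<times> UNIV) f"
  shows "hamiltonian_cycle_edges V ((\<lambda>i. {f (i, False), f (i, True)}) ` {..<n})" (is "_ V (?E ` _)")
    and "inj_on (\<lambda>i. {f (i, False), f (i, True)}) {..<n}"
proof -
  let ?S = "{..<n} \<times> (UNIV :: bool set)"
  have "V \<noteq> {}" using assms(2,3) by auto
  obtain xs where xs: "distinct (map f xs)" "f ` set xs = V"
    "\<forall>x\<in>?S. x \<in> set xs \<longleftrightarrow> flip x \<notin> set xs" "set xs \<subseteq> ?S"
    "\<forall>i<length xs. f (flip (xs ! i)) = f (xs ! (Suc i mod length xs))"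
    using single_cycle_list[OF assms(1) \<open>V \<noteq> {}\<close> assms(4) pairing_flip assms(5)] by (elim exE conjE) (rule that)
  let ?vs = "map f xs"
  have len: "length xs = n" using distinct_card[OF xs(1)] xs(2) assms(2) by simp
  let ?C = "\<lambda>i. {?vs ! i, ?vs ! (Suc i mod length ?vs)}"
  have C: "?C k = ?E (fst (xs ! k))" if k: "k < n" for k
  proof -
    have "Suc k mod n < n" using assms(3) by (intro mod_less_divisor) linarith
    then have "?C k = {f (xs ! k), f (flip (xs ! k))}" using xs(5) k len by simp
    then show ?thesis by (cases "xs ! k"; cases "snd (xs ! k)") (auto simp: flip_def)
  qed
  have "?E ` {..<n} = ?C ` {..<n}"
  proof (intro subset_antisym image_subsetI)
    fix i assume i: "i \<in> {..<n}"
    then have "(i, False) \<in> set xs \<or> (i, True) \<in> set xs"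
      using bspec[OF xs(3), of "(i, False)"] by (auto simp: flip_def)
    then obtain b where "(i, b) \<in> set xs" by blast
    then obtain k where k: "k < n" "xs ! k = (i, b)" using len by (auto simp: in_set_conv_nth)
    then have "?E i = ?C k" using C[OF k(1)] by simp
    then show "?E i \<in> ?C ` {..<n}" using k(1) by blast
  next
    fix k assume k: "k \<in> {..<n}"
    then have "xs ! k \<in> ?S" using xs(4) len nth_mem[of k xs] by auto
    then have "fst (xs ! k) \<in> {..<n}" by auto
    then show "?C k \<in> ?E ` {..<n}" using C[of k] k by blast
  qed
  note eq = this
  have "?C ` {..<n} = {?C i | i. i < length ?vs}"
    unfolding setcompr_eq_image length_map len lessThan_def ..
  then show "hamiltonian_cycle_edges V (?E ` {..<n})"
    unfolding hamiltonian_cycle_edges_def eq using xs(1,2) len assms(3)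
    by (intro exI[of _ ?vs] conjI) simp_all
  have "inj_on ?C {..<n}" using inj_on_cycle_edges[OF xs(1)] len assms(3) by simp
  then have "card (?E ` {..<n}) = card {..<n}" unfolding eq by (rule card_image)
  then show "inj_on ?E {..<n}" by (intro eq_card_imp_inj_on) auto
qed

text \<open>
  \<open>H i\<close> is the edge set of the \<open>i\<close>-th colour, and \<open>E i\<close> the edge of that colour. Such a map is the
  inverse of the bijection of a transversal.
\<close>

definition rainbow_cycles :: "'a set \<Rightarrow> nat \<Rightarrow> (nat \<Rightarrow> 'a set set) \<Rightarrow> (nat \<Rightarrow> 'a set) set" where
  "rainbow_cycles V n H =
    {E \<in> Pi\<^sub>E {..<n} H. inj_on E {..<n} \<and> hamiltonian_cycle_edges V (E ` {..<n})}"

text \<open>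
  Collapsing the given cycle outside \<open>A\<close> leaves the half-edges at \<open>A\<close> as stubs. As no two elements
  of \<open>A\<close> are consecutive, the other half of such an edge stays at its vertex outside \<open>A\<close>. Hence the
  stub can move to every \<open>a \<in> A\<close> that is joined to that vertex by an edge of the colour at hand, and
  its position can be read off from the edge of this colour in the resulting cycle.
\<close>

theorem fact_le_card_rainbow_cycles:
  fixes H :: "nat \<Rightarrow> 'a set set"
  assumes vs: "distinct vs" "3 \<le> length vs"
    and H: "\<And>i. i < length vs \<Longrightarrow> finite (H i)"
    and edge: "\<And>i. i < length vs \<Longrightarrow> {vs ! i, vs ! (Suc i mod length vs)} \<in> H i"
    and A: "A \<subseteq> set vs" "A \<noteq> {}"
    and sep: "\<And>i. i < length vs \<Longrightarrow> vs ! i \<in> A \<Longrightarrow> vs ! (Suc i mod length vs) \<notin> A"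
    and dom: "\<And>i b. i < length vs \<Longrightarrow> k \<le> card {a \<in> A. {a, end_of vs (i, b)} \<in> H i}"
  shows "fact k \<le> card (rainbow_cycles (set vs) (length vs) H)"
proof -
  let ?n = "length vs" and ?V = "set vs"
  let ?S = "{..<?n} \<times> (UNIV :: bool set)"
  let ?h = "end_of vs"
  let ?D = "{s \<in> ?S. ?h s \<in> A}"
  have finA: "finite A" using A(1) finite_subset by auto
  have tto: "two_to_one ?h ?S ?V" using two_to_one_end_of[OF vs(1)] vs(2) by simp
  have sc: "single_cycle flip ?S ?h" using single_cycle_end_of[of vs] vs(2) by simp
  obtain \<sigma> where \<sigma>: "pairing \<sigma> ?D" and col: "\<And>f. (\<forall>s\<in>?S. if ?h s \<in> A then f s \<in> A else f s = ?h s) \<Longrightarrow>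
      (single_cycle flip ?S f \<longleftrightarrow> single_cycle \<sigma> ?D f)"
    using collapse_fibres[OF _ A tto pairing_flip sc] by auto
  have other: "flip s \<in> ?S" "?h (flip s) \<notin> A" if "s \<in> ?D" for s
    using that sep by (auto simp: flip_def end_of_def split: if_splits)
  define N where "N s = {a \<in> A. {a, ?h (flip s)} \<in> H (fst s)}" for s
  have pair0: "{?h s, ?h (flip s)} = {vs ! i, vs ! (Suc i mod ?n)}" if "fst s = i" for s i
    using that by (cases s; cases "snd s") (auto simp: flip_def end_of_def)
  let ?Ham = "ham_maps \<sigma> ?D A N"
  have tto0: "two_to_one ?h ?D A"
    unfolding two_to_one_def
  proof (intro conjI ballI)
    fix a assume a: "a \<in> A"
    then have "{s \<in> ?D. ?h s = a} = {s \<in> ?S. ?h s = a}" by auto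
    then show "card {s \<in> ?D. ?h s = a} = 2" using tto a A(1) by (auto simp: two_to_one_def)
  qed auto
  have "restrict ?h ?D \<in> ?Ham"
  proof -
    have "single_cycle \<sigma> ?D ?h" using col[of ?h] sc by simp
    moreover have "?h s \<in> N s" if "s \<in> ?D" for s
      using that edge[of "fst s"] pair0[of s "fst s"] by (auto simp: N_def)
    ultimately show ?thesis
      using tto0 two_to_one_cong[of ?D "restrict ?h ?D" ?h] single_cycle_cong[of ?D "restrict ?h ?D" ?h]
      by (simp add: ham_maps_def)
  qed
  then have "fact k \<le> card ?Ham"
  proof (intro fact_le_card_ham_maps[OF _ finA A(2) \<sigma>])
    show "k \<le> card (N s)" if "s \<in> ?D" for s
    proof -
      obtain i b where "s = (i, b)" by fastforce
      then show ?thesis using dom[of i "\<not> b"] that by (simp add: N_def flip_def)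
    qed
  qed (auto simp: N_def)
  also have "\<dots> \<le> card (rainbow_cycles ?V ?n H)"
  proof -
    \<comment> \<open>Edges that do not meet \<open>A\<close> are kept from the given cycle.\<close>
    define full where "full f s = (if s \<in> ?D then f s else ?h s)" for f s
    define E where "E f = (\<lambda>i\<in>{..<?n}. {full f (i, False), full f (i, True)})" for f
    have Eflip: "E f (fst s) = {full f s, full f (flip s)}" if "s \<in> ?S" for f s
      using that by (cases s; cases "snd s") (auto simp: E_def flip_def)
    have E0: "E f (fst s) = {f s, ?h (flip s)}" if "s \<in> ?D" for f s
      using Eflip[of s f] other[OF that] that by (simp add: full_def)
    have "E f \<in> rainbow_cycles ?V ?n H" if f: "f \<in> ?Ham" for f
    proof -
      have fA: "f s \<in> A" "f s \<in> N s" if "s \<in> ?D" for s using f that by (auto simp: ham_maps_def)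
      have ttof: "two_to_one f ?D A" and scf: "single_cycle \<sigma> ?D f" using f by (auto simp: ham_maps_def)
      have tf: "two_to_one (full f) ?S ?V"
        unfolding two_to_one_def
      proof (intro conjI ballI)
        show "full f ` ?S \<subseteq> ?V"
        proof (rule image_subsetI)
          fix s assume "s \<in> ?S"
          then show "full f s \<in> ?V" using fA(1) A(1) tto by (auto simp: full_def two_to_one_def)
        qed
        fix a assume a: "a \<in> ?V"
        show "card {s \<in> ?S. full f s = a} = 2"
        proof (cases "a \<in> A")
          case True
          then have "{s \<in> ?S. full f s = a} = {s \<in> ?D. f s = a}" by (auto simp: full_def)
          then show ?thesis using ttof True by (auto simp: two_to_one_def)
        next
          case False
          then have "{s \<in> ?S. full f s = a} = {s \<in> ?S. ?h s = a}" using fA(1) by (auto simp: full_def)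
          then show ?thesis using tto a by (auto simp: two_to_one_def)
        qed
      qed
      have "single_cycle \<sigma> ?D (full f)"
        using scf single_cycle_cong[of ?D "full f" f \<sigma>] by (simp add: full_def)
      then have sf: "single_cycle flip ?S (full f)" using col[of "full f"] fA(1) by (simp add: full_def)
      have cV: "card ?V = ?n" using distinct_card[OF vs(1)] .
      note h = hamiltonian_cycle_of_single_cycle[OF _ cV vs(2) tf sf]
      have im: "E f ` {..<?n} = (\<lambda>i. {full f (i, False), full f (i, True)}) ` {..<?n}"
        by (simp add: E_def)
      have inj: "inj_on (E f) {..<?n}" using h(2) by (simp add: E_def inj_on_def)
      have "E f i \<in> H i" if i: "i < ?n" for i
      proof (cases "\<exists>b. (i, b) \<in> ?D")
        case True
        then obtain b where b: "(i, b) \<in> ?D" by blast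
        then show ?thesis using E0[OF b, of f] fA(2)[OF b] by (simp add: N_def)
      next
        case False
        then have "E f i = {?h (i, False), ?h (i, True)}" using i by (simp add: E_def full_def)
        then show ?thesis using edge[OF i] by (simp add: end_of_def)
      qed
      then have "E f \<in> Pi\<^sub>E {..<?n} H" by (auto simp: E_def)
      then show ?thesis using h(1) inj im by (simp add: rainbow_cycles_def)
    qed
    moreover have "inj_on E ?Ham"
    proof (rule inj_onI)
      fix f g assume fg: "f \<in> ?Ham" "g \<in> ?Ham" "E f = E g"
      show "f = g"
      proof
        fix s show "f s = g s"
        proof (cases "s \<in> ?D")
          case True
          then have "{f s, ?h (flip s)} = {g s, ?h (flip s)}" using E0[of s f] E0[of s g] fg(3) by simp
          then show ?thesis by (auto simp: doubleton_eq_iff)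
        next
          case False
          then have "f s = undefined" "g s = undefined" using fg(1,2)
            unfolding ham_maps_def PiE_def extensional_def by blast+
          then show ?thesis by simp
        qed
      qed
    qed
    moreover have "finite (rainbow_cycles ?V ?n H)"
      unfolding rainbow_cycles_def
      by (rule finite_subset[of _ "Pi\<^sub>E {..<?n} H"]) (use H in \<open>auto intro: finite_PiE\<close>)
    ultimately show ?thesis by (intro card_inj_on_le[of E]) auto
  qed
  finally show ?thesis .
qed

section \<open>Descents of a bit sequence that meet many sets\<close>

text \<open>
  Let each event \<open>e\<close> depend on the bits in \<open>V e\<close> and be bad for the patterns in \<open>B e\<close>; a set \<open>Y\<close>
  stands for the assignment of 1 to its elements. Counting in the style of Rosenfeld shows that the
  number \<open>g W\<close> of assignments on \<open>W\<close> which no event inside \<open>W\<close> spoils grows at least by the factor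
  \<open>\<beta>\<close> with every new bit \<open>u\<close>. Indeed there are \<open>2 * g W\<close> extensions, and those spoiled by an event
  \<open>e\<close> at \<open>u\<close> consist of a bad pattern on \<open>V e\<close> and a good assignment on \<open>W - V e\<close>. By induction the number of
  the latter is at most \<open>g W / \<beta> ^ r\<close>, as \<open>r\<close> bits were removed from \<open>W\<close>. So at most
  \<open>D * b * g W / \<beta> ^ r \<le> (2 - \<beta>) * g W\<close> extensions are lost.
\<close>

lemma local_counting:
  fixes V :: "'e \<Rightarrow> 'u set" and B :: "'e \<Rightarrow> 'u set set" and \<beta> b :: real
  assumes fin: "finite U" "finite J"
    and V: "\<And>e. e \<in> J \<Longrightarrow> V e \<subseteq> U" "\<And>e. e \<in> J \<Longrightarrow> card (V e) = Suc r"
    and B: "\<And>e. e \<in> J \<Longrightarrow> B e \<subseteq> Pow (V e)" "\<And>e. e \<in> J \<Longrightarrow> real (card (B e)) \<le> b"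
    and D: "\<And>u. u \<in> U \<Longrightarrow> card {e \<in> J. u \<in> V e} \<le> D"
    and \<beta>: "0 < \<beta>" "real D * b \<le> (2 - \<beta>) * \<beta> ^ r" and b: "0 \<le> b"
  shows "\<exists>Y\<subseteq>U. \<forall>e\<in>J. Y \<inter> V e \<notin> B e"
proof -
  define good where "good W = {Y \<in> Pow W. \<forall>e\<in>J. V e \<subseteq> W \<longrightarrow> Y \<inter> V e \<notin> B e}" for W
  define g where "g W = real (card (good W))" for W
  have fin_good: "finite (good W)" if "W \<subseteq> U" for W
    using that fin(1) finite_subset[of W U] by (auto simp: good_def)
  have step: "\<beta> * g W \<le> g (insert u W)" if "W \<subseteq> U" "u \<in> U" "u \<notin> W" for W u
    using that
  proof (induction "card W" arbitrary: W u rule: less_induct)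
    case less
    have finW: "finite W" using less.prems(1) fin(1) finite_subset by auto
    \<comment> \<open>The growth on all smaller sets, iterated over the elements of \<open>X\<close>.\<close>
    have chain: "\<beta> ^ card X * g (W - X) \<le> g W" if "X \<subseteq> W" for X
    proof -
      have "finite X" using that finW finite_subset by auto
      then show ?thesis using that
      proof (induction X rule: finite_induct)
        case empty
        then show ?case by simp
      next
        case (insert x X)
        have "\<beta> * g (W - insert x X) \<le> g (insert x (W - insert x X))"
        proof (rule less.hyps)
          show "card (W - insert x X) < card W"
            by (rule psubset_card_mono[OF finW]) (use insert.prems in auto)
        qed (use less.prems insert.prems in auto)
        moreover have "insert x (W - insert x X) = W - X" using insert by auto
        ultimately have "\<beta> * g (W - insert x X) \<le> g (W - X)" by simp
        then have "\<beta> ^ card X * (\<beta> * g (W - insert x X)) \<le> \<beta> ^ card X * g (W - X)"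
          using \<beta>(1) by (intro mult_left_mono) auto
        then show ?case using insert by (simp add: mult.assoc mult.left_commute)
      qed
    qed
    let ?W = "insert u W"
    define All where "All = good W \<union> insert u ` good W"
    define Ju where "Ju = {e \<in> J. u \<in> V e \<and> V e \<subseteq> ?W}"
    define bad where "bad e = {Y \<in> All. Y \<inter> V e \<in> B e}" for e
    have finJu: "finite Ju" using fin(2) by (simp add: Ju_def)
    have finAll: "finite All" using fin_good[OF less.prems(1)] by (simp add: All_def)
    have goodW: "Y \<subseteq> W" if "Y \<in> good W" for Y using that by (auto simp: good_def)
    have AllW: "Y \<subseteq> ?W" "Y \<inter> W \<in> good W" if "Y \<in> All" for Y
    proof -
      from that consider "Y \<in> good W" | Z where "Z \<in> good W" "Y = insert u Z" by (auto simp: All_def)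
      then have "Y \<subseteq> ?W \<and> Y \<inter> W \<in> good W"
      proof cases
        case 1
        then show ?thesis using goodW[OF 1] by (auto simp: Int_absorb2)
      next
        case 2
        then have "Y \<inter> W = Z" using goodW[OF 2(1)] less.prems(3) by auto
        then show ?thesis using 2 goodW[OF 2(1)] by auto
      qed
      then show "Y \<subseteq> ?W" "Y \<inter> W \<in> good W" by auto
    qed
    have cAll: "real (card All) = 2 * g W"
    proof -
      have "inj_on (insert u) (good W)"
        using goodW less.prems(3) by (intro inj_onI) (metis insert_ident subsetD)
      then have "card (insert u ` good W) = card (good W)" by (rule card_image)
      moreover have "good W \<inter> insert u ` good W = {}" using goodW less.prems(3) by blast
      ultimately show ?thesis
        using fin_good[OF less.prems(1)] by (simp add: All_def card_Un_disjoint g_def)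
    qed
    have cbad: "real (card (bad e)) * \<beta> ^ r \<le> b * g W" if e: "e \<in> Ju" for e
    proof -
      have eJ: "e \<in> J" "u \<in> V e" "V e \<subseteq> ?W" using e by (auto simp: Ju_def)
      have finV: "finite (V e)" using V(1)[OF eJ(1)] fin(1) finite_subset by auto
      have "card (bad e) \<le> card (B e \<times> good (W - V e))"
      proof (rule card_inj_on_le[of "\<lambda>Y. (Y \<inter> V e, Y - V e)"])
        show "inj_on (\<lambda>Y. (Y \<inter> V e, Y - V e)) (bad e)" by (rule inj_onI) auto
        show "(\<lambda>Y. (Y \<inter> V e, Y - V e)) ` bad e \<subseteq> B e \<times> good (W - V e)"
        proof (intro image_subsetI SigmaI)
          fix Y assume Y: "Y \<in> bad e"
          show "Y \<inter> V e \<in> B e" using Y by (simp add: bad_def)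
          have YA: "Y \<subseteq> ?W" "Y \<inter> W \<in> good W" using AllW Y by (auto simp: bad_def)
          have "(Y - V e) \<inter> V e' \<notin> B e'" if "e' \<in> J" "V e' \<subseteq> W - V e" for e'
          proof -
            have "(Y - V e) \<inter> V e' = (Y \<inter> W) \<inter> V e'" using that(2) by auto
            then show ?thesis using YA(2) that by (auto simp: good_def)
          qed
          then show "Y - V e \<in> good (W - V e)" using YA(1) eJ by (auto simp: good_def)
        qed
        have "finite (B e)" using B(1)[OF eJ(1)] finV finite_subset by auto
        then show "finite (B e \<times> good (W - V e))" using fin_good[of "W - V e"] less.prems(1) by auto
      qed
      then have "real (card (bad e)) \<le> real (card (B e)) * g (W - V e)"
        by (simp add: card_cartesian_product g_def flip: of_nat_mult)
      also have "\<dots> \<le> b * g (W - V e)" using B(2)[OF eJ(1)] by (rule mult_right_mono) (simp add: g_def)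
      finally have "real (card (bad e)) * \<beta> ^ r \<le> b * g (W - V e) * \<beta> ^ r"
        using \<beta>(1) by (intro mult_right_mono) auto
      also have "\<dots> = b * (\<beta> ^ r * g (W - V e))" by simp
      also have "\<dots> \<le> b * g W"
      proof (rule mult_left_mono[OF _ b])
        have "card (V e - {u}) = r" using V(2)[OF eJ(1)] eJ(2) by simp
        moreover have "W - (V e - {u}) = W - V e" using less.prems(3) by auto
        ultimately show "\<beta> ^ r * g (W - V e) \<le> g W" using chain[of "V e - {u}"] eJ(3) by auto
      qed
      finally show ?thesis .
    qed
    have "All - (\<Union>e\<in>Ju. bad e) \<subseteq> good ?W"
    proof
      fix Y assume Y: "Y \<in> All - (\<Union>e\<in>Ju. bad e)"
      have "Y \<inter> V e \<notin> B e" if "e \<in> J" "V e \<subseteq> ?W" for e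
      proof (cases "u \<in> V e")
        case True
        then show ?thesis using Y that by (auto simp: Ju_def bad_def)
      next
        case False
        then have "V e \<subseteq> W" "Y \<inter> V e = (Y \<inter> W) \<inter> V e" using that(2) by auto
        then show ?thesis using AllW(2)[of Y] Y that(1) by (auto simp: good_def)
      qed
      then show "Y \<in> good ?W" using AllW(1)[of Y] Y by (auto simp: good_def)
    qed
    then have "card (All - (\<Union>e\<in>Ju. bad e)) \<le> card (good ?W)"
      using fin_good[of ?W] less.prems by (intro card_mono) auto
    moreover have "card All \<le> card (All - (\<Union>e\<in>Ju. bad e)) + card (\<Union>e\<in>Ju. bad e)"
    proof -
      have "(\<Union>e\<in>Ju. bad e) \<subseteq> All" by (auto simp: bad_def)
      then show ?thesis using finAll by (simp add: card_Diff_subset finite_subset card_mono)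
    qed
    moreover have "card (\<Union>e\<in>Ju. bad e) \<le> (\<Sum>e\<in>Ju. card (bad e))" by (rule card_UN_le[OF finJu])
    ultimately have "card All \<le> card (good ?W) + (\<Sum>e\<in>Ju. card (bad e))" by linarith
    then have "real (card All) \<le> real (card (good ?W) + (\<Sum>e\<in>Ju. card (bad e)))"
      by (rule of_nat_mono)
    then have main: "2 * g W \<le> g ?W + (\<Sum>e\<in>Ju. real (card (bad e)))" using cAll by (simp add: g_def)
    have "(\<Sum>e\<in>Ju. real (card (bad e))) * \<beta> ^ r = (\<Sum>e\<in>Ju. real (card (bad e)) * \<beta> ^ r)"
      by (rule sum_distrib_right)
    also have "\<dots> \<le> (\<Sum>e\<in>Ju. b * g W)" by (rule sum_mono) (rule cbad)
    also have "\<dots> = real (card Ju) * (b * g W)" by simp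
    also have "\<dots> \<le> real D * (b * g W)"
    proof (rule mult_right_mono)
      have "card Ju \<le> card {e \<in> J. u \<in> V e}" by (rule card_mono) (use fin(2) in \<open>auto simp: Ju_def\<close>)
      then show "real (card Ju) \<le> real D" using D[OF less.prems(2)] by simp
      show "0 \<le> b * g W" using b by (simp add: g_def)
    qed
    also have "\<dots> = (real D * b) * g W" by simp
    also have "\<dots> \<le> ((2 - \<beta>) * \<beta> ^ r) * g W" using \<beta>(2) by (rule mult_right_mono) (simp add: g_def)
    also have "\<dots> = ((2 - \<beta>) * g W) * \<beta> ^ r" by simp
    finally have "(\<Sum>e\<in>Ju. real (card (bad e))) \<le> (2 - \<beta>) * g W"
      using \<beta>(1) by simp
    then show ?case using main by (simp add: algebra_simps)
  qed
  have "g W > 0" if "W \<subseteq> U" for W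
  proof -
    have "finite W" using that fin(1) finite_subset by auto
    then show ?thesis using that
    proof (induction W rule: finite_induct)
      case empty
      have "V e \<noteq> {}" if "e \<in> J" for e using V(2)[OF that] by auto
      then have "good {} = {{}}" by (auto simp: good_def)
      then show ?case by (simp add: g_def)
    next
      case (insert u W)
      then have "0 < \<beta> * g W" using \<beta>(1) by simp
      also have "\<dots> \<le> g (insert u W)" using insert by (intro step) auto
      finally show ?case .
    qed
  qed
  from this[of U] have "good U \<noteq> {}" by (auto simp: g_def)
  then show ?thesis using V(1) by (auto simp: good_def)
qed

text \<open>
  A pattern without descent is determined by the bits of \<open>j\<close> and \<open>s j\<close>, and for each \<open>j\<close> one of the
  four combinations is excluded.
\<close>

lemma card_no_descent:
  assumes "finite Q"
  shows "card {Z \<in> Pow (Q \<union> s ` Q). \<forall>j\<in>Q. \<not> (j \<in> Z \<and> s j \<notin> Z)} \<le> 3 ^ card Q"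
proof -
  let ?P = "{(False, False), (False, True), (True, True)}"
  let ?h = "\<lambda>Z. \<lambda>j\<in>Q. (j \<in> Z, s j \<in> Z)"
  have "card {Z \<in> Pow (Q \<union> s ` Q). \<forall>j\<in>Q. \<not> (j \<in> Z \<and> s j \<notin> Z)} \<le> card (Q \<rightarrow>\<^sub>E ?P)"
  proof (rule card_inj_on_le[of ?h])
    show "inj_on ?h {Z \<in> Pow (Q \<union> s ` Q). \<forall>j\<in>Q. \<not> (j \<in> Z \<and> s j \<notin> Z)}"
    proof (rule inj_onI)
      fix Z Z' assume Z: "Z \<in> {Z \<in> Pow (Q \<union> s ` Q). \<forall>j\<in>Q. \<not> (j \<in> Z \<and> s j \<notin> Z)}"
        "Z' \<in> {Z \<in> Pow (Q \<union> s ` Q). \<forall>j\<in>Q. \<not> (j \<in> Z \<and> s j \<notin> Z)}" and eq: "?h Z = ?h Z'"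
      have "(j \<in> Z \<longleftrightarrow> j \<in> Z') \<and> (s j \<in> Z \<longleftrightarrow> s j \<in> Z')" if "j \<in> Q" for j
        using fun_cong[OF eq, of j] that by simp
      then show "Z = Z'" using Z by blast
    qed
    show "?h ` {Z \<in> Pow (Q \<union> s ` Q). \<forall>j\<in>Q. \<not> (j \<in> Z \<and> s j \<notin> Z)} \<subseteq> Q \<rightarrow>\<^sub>E ?P" by auto
    show "finite (Q \<rightarrow>\<^sub>E ?P)" using assms by (intro finite_PiE) auto
  qed
  then show ?thesis using assms by (simp add: card_PiE numeral_3_eq_3)
qed

text \<open>
  Greedy choice: a chosen element excludes only itself, its successor and its predecessor.
\<close>

lemma nonadjacent_subset:
  assumes "finite M" "inj_on s M" "\<And>j. j \<in> M \<Longrightarrow> s j \<noteq> j" "3 * r \<le> card M"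
  shows "\<exists>Q\<subseteq>M. card Q = r \<and> Q \<inter> s ` Q = {}"
  using assms
proof (induction r arbitrary: M)
  case 0
  then show ?case by (intro exI[of _ "{}"]) simp
next
  case (Suc r)
  have "card M \<noteq> 0" using Suc.prems(4) by auto
  then obtain j where j: "j \<in> M" by fastforce
  let ?X = "{j, s j} \<union> {x \<in> M. s x = j}"
  have "card {x \<in> M. s x = j} \<le> card {j}"
    by (rule card_inj_on_le[of s]) (use Suc.prems(2) in \<open>auto simp: inj_on_def\<close>)
  moreover have "card {j, s j} \<le> 2" by (simp add: card_insert_if)
  moreover have "card ?X \<le> card {j, s j} + card {x \<in> M. s x = j}" by (rule card_Un_le)
  ultimately have "card ?X \<le> 3" by simp
  then have "3 * r \<le> card (M - ?X)" using Suc.prems(1,4) diff_card_le_card_Diff[of ?X M] by auto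
  moreover have "inj_on s (M - ?X)" using Suc.prems(2) by (rule inj_on_subset) auto
  ultimately obtain Q where Q: "Q \<subseteq> M - ?X" "card Q = r" "Q \<inter> s ` Q = {}"
    using Suc.IH[of "M - ?X"] Suc.prems(1,3) by blast
  have "finite Q" using Q(1) Suc.prems(1) finite_subset by blast
  have "insert j Q \<inter> s ` insert j Q = {}" using Q(1,3) Suc.prems(3)[OF j] by auto
  moreover have "card (insert j Q) = Suc r" using Q(1,2) \<open>finite Q\<close> by (subst card_insert_disjoint) auto
  ultimately show ?case using Q(1) j by (intro exI[of _ "insert j Q"]) auto
qed

lemma split_into_groups:
  assumes "card M = k * g" "finite M"
  shows "\<exists>P. (\<forall>l<k. P l \<subseteq> M \<and> card (P l) = g) \<and> (\<forall>l<k. \<forall>l'<k. l \<noteq> l' \<longrightarrow> P l \<inter> P l' = {})"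
  using assms
proof (induction k arbitrary: M)
  case 0
  then show ?case by simp
next
  case (Suc k)
  then have "g \<le> card M" by simp
  then obtain X where X: "X \<subseteq> M" "card X = g" by (rule obtain_subset_with_card_n)
  have "card (M - X) = k * g" using X Suc.prems by (simp add: card_Diff_subset finite_subset)
  then obtain P where P: "\<forall>l<k. P l \<subseteq> M - X \<and> card (P l) = g"
    "\<forall>l<k. \<forall>l'<k. l \<noteq> l' \<longrightarrow> P l \<inter> P l' = {}" using Suc.IH[of "M - X"] Suc.prems(2) by auto
  let ?P = "P(k := X)"
  have "?P l \<subseteq> M \<and> card (?P l) = g" if "l < Suc k" for l
  proof (cases "l = k")
    case False
    then have "l < k" using that by simp
    then have "P l \<subseteq> M - X \<and> card (P l) = g" using P(1) by blast
    then show ?thesis using False by auto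
  qed (use X in simp)
  moreover have "?P l \<inter> ?P l' = {}" if "l < Suc k" "l' < Suc k" "l \<noteq> l'" for l l'
  proof -
    consider "l = k" "l' < k" | "l < k" "l' = k" | "l < k" "l' < k" using \<open>l < Suc k\<close> \<open>l' < Suc k\<close> \<open>l \<noteq> l'\<close> by linarith
    then show ?thesis
    proof cases
      case 1
      then have "P l' \<subseteq> M - X" using P(1) by blast
      then show ?thesis using 1 by auto
    next
      case 2
      then have "P l \<subseteq> M - X" using P(1) by blast
      then show ?thesis using 2 by auto
    next
      case 3 then show ?thesis using P(2) \<open>l \<noteq> l'\<close> by auto
    qed
  qed
  ultimately show ?case by blast
qed

text \<open>
  Apply the counting lemma to the \<open>k\<close> groups of every set \<open>M i\<close>; the event of a group is that it
  contains no descent. It depends on \<open>2 * g\<close> bits and is bad for \<open>3 ^ g\<close> patterns, and a bit lies in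
  at most \<open>2 * D * k\<close> events, as it may be an element of the group or the successor of one. The growth
  rate \<open>9 / 5\<close> serves because \<open>(9 / 5)\<^sup>2 = 81 / 25\<close> exceeds 3: the quotient \<open>3 / (81 / 25) = 25 / 27\<close>
  is the base in the last assumption, and \<open>18\<close> is \<open>2\<close> divided by \<open>(2 - 9 / 5) * (5 / 9) = 1 / 9\<close>.
\<close>

lemma descents_dominate:
  fixes M :: "'i \<Rightarrow> 'u set"
  assumes fin: "finite U" "finite I" and s: "s ` U \<subseteq> U" "inj_on s U" "\<And>j. j \<in> U \<Longrightarrow> s j \<noteq> j"
    and M: "\<And>i. i \<in> I \<Longrightarrow> M i \<subseteq> U" "\<And>i. i \<in> I \<Longrightarrow> 3 * (k * g) \<le> card (M i)"
    and D: "\<And>j. j \<in> U \<Longrightarrow> card {i \<in> I. j \<in> M i} \<le> D"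
    and g: "0 < g" and small: "18 * real D * real k * (25 / 27) ^ g \<le> (1 :: real)"
  shows "\<exists>Y\<subseteq>U. \<forall>i\<in>I. k \<le> card {j \<in> M i. j \<in> Y \<and> s j \<notin> Y}"
proof -
  have finM: "finite (M i)" if "i \<in> I" for i using M(1)[OF that] fin(1) finite_subset by auto
  have "\<exists>P. (\<forall>l<k. P l \<subseteq> M i \<and> card (P l) = g \<and> P l \<inter> s ` P l = {}) \<and>
    (\<forall>l<k. \<forall>l'<k. l \<noteq> l' \<longrightarrow> P l \<inter> P l' = {})" if i: "i \<in> I" for i
  proof -
    obtain Q where Q: "Q \<subseteq> M i" "card Q = k * g" "Q \<inter> s ` Q = {}"
      using nonadjacent_subset[of "M i" s "k * g"] finM[OF i] M(1,2)[OF i] s(2,3) inj_on_subset by blast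
    have "finite Q" using Q(1) finM[OF i] finite_subset by auto
    then obtain P where P: "\<forall>l<k. P l \<subseteq> Q \<and> card (P l) = g"
      "\<forall>l<k. \<forall>l'<k. l \<noteq> l' \<longrightarrow> P l \<inter> P l' = {}"
      using split_into_groups[OF Q(2)] by auto
    have "P l \<inter> s ` P l = {}" if "l < k" for l using P(1) that Q(3) by blast
    then show ?thesis using P Q(1) by (intro exI[of _ P]) blast
  qed
  then obtain P where P: "\<And>i l. i \<in> I \<Longrightarrow> l < k \<Longrightarrow> P i l \<subseteq> M i \<and> card (P i l) = g \<and> P i l \<inter> s ` P i l = {}"
    "\<And>i l l'. i \<in> I \<Longrightarrow> l < k \<Longrightarrow> l' < k \<Longrightarrow> l \<noteq> l' \<Longrightarrow> P i l \<inter> P i l' = {}" by metis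
  let ?J = "I \<times> {..<k}"
  define V where "V e = P (fst e) (snd e) \<union> s ` P (fst e) (snd e)" for e
  define B where "B e = {Z \<in> Pow (V e). \<forall>j\<in>P (fst e) (snd e). \<not> (j \<in> Z \<and> s j \<notin> Z)}" for e
  have PU: "P i l \<subseteq> U" if "i \<in> I" "l < k" for i l using P(1)[OF that] M(1)[OF that(1)] by blast
  have "\<exists>Y\<subseteq>U. \<forall>e\<in>?J. Y \<inter> V e \<notin> B e"
  proof (rule local_counting[where r = "2 * g - 1" and D = "2 * D * k" and \<beta> = "9/5" and b = "3 ^ g"])
    fix e assume e: "e \<in> ?J"
    let ?Q = "P (fst e) (snd e)"
    have Q: "?Q \<subseteq> U" "card ?Q = g" "?Q \<inter> s ` ?Q = {}"
      using PU[of "fst e" "snd e"] P(1)[of "fst e" "snd e"] e by (simp_all add: mem_Times_iff)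
    have finQ: "finite ?Q" using Q(1) fin(1) finite_subset by auto
    show "V e \<subseteq> U" using Q(1) s(1) by (auto simp: V_def)
    have "card (s ` ?Q) = g" using card_image[OF inj_on_subset[OF s(2) Q(1)]] Q(2) by simp
    then show "card (V e) = Suc (2 * g - 1)"
      using Q finQ g by (simp add: V_def card_Un_disjoint)
    show "B e \<subseteq> Pow (V e)" by (auto simp: B_def)
    have "card (B e) \<le> 3 ^ g" using card_no_descent[OF finQ, of s] Q(2) by (simp add: B_def V_def)
    then have "real (card (B e)) \<le> real (3 ^ g)" by (rule of_nat_mono)
    then show "real (card (B e)) \<le> 3 ^ g" by simp
  next
    fix u assume u: "u \<in> U"
    let ?I1 = "{i \<in> I. u \<in> M i}" and ?I2 = "{i \<in> I. \<exists>j\<in>M i. s j = u}"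
    have "card ?I2 \<le> D"
    proof (cases "\<exists>j\<in>U. s j = u")
      case True
      then obtain j where j: "j \<in> U" "s j = u" by auto
      have "?I2 \<subseteq> {i \<in> I. j \<in> M i}" using j s(2) M(1) by (auto simp: inj_on_def)
      then have "card ?I2 \<le> card {i \<in> I. j \<in> M i}" using fin(2) by (intro card_mono) auto
      then show ?thesis using D[OF j(1)] by linarith
    next
      case False
      then have "?I2 = {}" using M(1) by blast
      then show ?thesis by (metis card.empty zero_le)
    qed
    have "{e \<in> ?J. u \<in> V e} \<subseteq> (?I1 \<union> ?I2) \<times> {..<k}"
    proof
      fix e assume e: "e \<in> {e \<in> ?J. u \<in> V e}"
      then have "P (fst e) (snd e) \<subseteq> M (fst e)" using P(1)[of "fst e" "snd e"] by (simp add: mem_Times_iff)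
      then show "e \<in> (?I1 \<union> ?I2) \<times> {..<k}" using e by (fastforce simp: V_def)
    qed
    then have "card {e \<in> ?J. u \<in> V e} \<le> card ((?I1 \<union> ?I2) \<times> {..<k})"
      using fin(2) by (intro card_mono) auto
    also have "\<dots> = card (?I1 \<union> ?I2) * k" by (simp add: card_cartesian_product)
    also have "\<dots> \<le> (2 * D) * k"
      using card_Un_le[of ?I1 ?I2] D[OF u] \<open>card ?I2 \<le> D\<close> by (intro mult_right_mono) linarith+
    finally show "card {e \<in> ?J. u \<in> V e} \<le> 2 * D * k" .
  next
    have "(9 / 5 :: real) ^ (2 * g - 1) = (9 / 5) ^ (2 * g) * (5 / 9)"
      using g power_Suc[of "9 / 5 :: real" "2 * g - 1"] by simp
    also have "(9 / 5 :: real) ^ (2 * g) = (81 / 25) ^ g" by (simp add: power_mult power2_eq_square)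
    finally have 1: "(9 / 5 :: real) ^ (2 * g - 1) = (81 / 25) ^ g * (5 / 9)" .
    have "(25 / 27 :: real) ^ g * (81 / 25) ^ g = 3 ^ g" by (simp flip: power_mult_distrib)
    then have "18 * real D * real k * 3 ^ g = 18 * real D * real k * (25 / 27) ^ g * (81 / 25) ^ g"
      by simp
    also have "\<dots> \<le> 1 * (81 / 25) ^ g" using small by (rule mult_right_mono) simp
    finally show "real (2 * D * k) * 3 ^ g \<le> (2 - 9 / 5) * (9 / 5) ^ (2 * g - 1)"
      unfolding 1 by simp
  qed (use fin in auto)
  then obtain Y where Y: "Y \<subseteq> U" "\<And>e. e \<in> ?J \<Longrightarrow> Y \<inter> V e \<notin> B e" by blast
  have "k \<le> card {j \<in> M i. j \<in> Y \<and> s j \<notin> Y}" if i: "i \<in> I" for i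
  proof -
    have "\<exists>j\<in>P i l. j \<in> Y \<and> s j \<notin> Y" if "l < k" for l
      using Y(2)[of "(i, l)"] i that by (auto simp: B_def V_def)
    then obtain h where h: "\<And>l. l < k \<Longrightarrow> h l \<in> P i l \<and> h l \<in> Y \<and> s (h l) \<notin> Y" by metis
    have "inj_on h {..<k}"
    proof (rule inj_onI)
      fix l l' assume "l \<in> {..<k}" "l' \<in> {..<k}" "h l = h l'"
      then have "h l \<in> P i l \<inter> P i l'" using h[of l] h[of l'] by auto
      then show "l = l'" using P(2)[OF i, of l l'] \<open>l \<in> {..<k}\<close> \<open>l' \<in> {..<k}\<close> by auto
    qed
    moreover have "h ` {..<k} \<subseteq> {j \<in> M i. j \<in> Y \<and> s j \<notin> Y}" using h P(1)[OF i] by blast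
    ultimately have "card {..<k} \<le> card {j \<in> M i. j \<in> Y \<and> s j \<notin> Y}"
      using finM[OF i] by (intro card_inj_on_le) auto
    then show ?thesis by simp
  qed
  then show ?thesis using Y(1) by blast
qed

section \<open>Hamiltonian transversals\<close>

lemma degree_le_max_degree:
  assumes "simple_graph G" "v \<in> verts G"
  shows "degree G v \<le> max_degree G"
  using assms unfolding max_degree_def simple_graph_def by (intro Max_ge) auto

lemma min_degree_le_degree:
  assumes "finite (verts G)" "v \<in> verts G"
  shows "min_degree G \<le> degree G v"
  using assms unfolding min_degree_def by (intro Min_le) auto

lemma finite_edges: "simple_graph G \<Longrightarrow> finite (edges G)"
  by (rule finite_subset[of _ "Pow (verts G)"]) (auto simp: simple_graph_def)

lemma degree_eq_card_positions:
  assumes vs: "distinct vs" and H: "\<And>e. e \<in> edges H \<Longrightarrow> e \<subseteq> set vs \<and> card e = 2"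
  shows "degree H w = card {j. j < length vs \<and> {vs ! j, w} \<in> edges H}"
proof -
  have "bij_betw (\<lambda>j. {vs ! j, w}) {j. j < length vs \<and> {vs ! j, w} \<in> edges H} {e \<in> edges H. w \<in> e}"
    unfolding bij_betw_def
  proof
    show "inj_on (\<lambda>j. {vs ! j, w}) {j. j < length vs \<and> {vs ! j, w} \<in> edges H}"
      using nth_eq_iff_index_eq[OF vs] by (auto intro!: inj_onI simp: doubleton_eq_iff)
    show "(\<lambda>j. {vs ! j, w}) ` {j. j < length vs \<and> {vs ! j, w} \<in> edges H} = {e \<in> edges H. w \<in> e}"
    proof (intro subset_antisym subsetI)
      fix e assume e: "e \<in> {e \<in> edges H. w \<in> e}"
      then have "card e = 2" "e \<subseteq> set vs" using H by auto
      then obtain x y where "e = {x, y}" by (auto simp: card_2_iff)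
      then obtain v where v: "e = {v, w}" using e by auto
      then have "v \<in> set vs" using \<open>e \<subseteq> set vs\<close> by auto
      then obtain j where "j < length vs" "vs ! j = v" by (auto simp: in_set_conv_nth)
      then show "e \<in> (\<lambda>j. {vs ! j, w}) ` {j. j < length vs \<and> {vs ! j, w} \<in> edges H}"
        using v e by auto
    qed auto
  qed
  then show ?thesis unfolding degree_def by (simp add: bij_betw_same_card)
qed

lemma inj_on_end_of:
  assumes "distinct vs" "0 < length vs"
  shows "inj_on (\<lambda>i. end_of vs (i, b)) {..<length vs}"
proof (rule inj_onI)
  let ?n = "length vs"
  fix i j assume ij: "i \<in> {..<?n}" "j \<in> {..<?n}" "end_of vs (i, b) = end_of vs (j, b)"
  have lt: "Suc i mod ?n < ?n" "Suc j mod ?n < ?n" using assms(2) by auto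
  show "i = j"
  proof (cases b)
    case True
    then have "Suc i mod ?n = Suc j mod ?n"
      using ij(3) nth_eq_iff_index_eq[OF assms(1) lt] by (simp add: end_of_def)
    then show ?thesis using inj_on_Suc_mod[of ?n] ij by (auto simp: inj_on_def)
  next
    case False
    then show ?thesis using ij nth_eq_iff_index_eq[OF assms(1), of i j] by (simp add: end_of_def)
  qed
qed

text \<open>
  \<open>M s\<close> consists of the positions to which the other half of the half-edge \<open>s\<close> may move. A position
  lies in at most twice as many of these sets as its degree in \<open>G\<close>, since a neighbour determines the
  half-edge up to its orientation. The descents of the resulting bits are the positions of \<open>A\<close>.
\<close>

lemma rainbow_cycles_of_large_degree:
  fixes c :: "nat \<Rightarrow> nat" and F :: "nat \<Rightarrow> 'a sgraph"
  assumes vs: "distinct vs" "3 \<le> length vs" and G: "simple_graph G" "verts G = set vs"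
    and c: "\<And>i. i < length vs \<Longrightarrow> spanning_subgraph (F (c i)) G"
    and edge: "\<And>i. i < length vs \<Longrightarrow> {vs ! i, vs ! (Suc i mod length vs)} \<in> edges (F (c i))"
    and deg: "\<And>i. i < length vs \<Longrightarrow> 3 * (k * g) \<le> min_degree (F (c i))"
    and g: "0 < g" "0 < k" and small: "36 * real (max_degree G) * real k * (25 / 27) ^ g \<le> 1"
  shows "fact k \<le> card (rainbow_cycles (set vs) (length vs) (\<lambda>i. edges (F (c i))))"
proof -
  let ?n = "length vs" and ?V = "set vs"
  let ?S = "{..<?n} \<times> (UNIV :: bool set)" and ?s = "\<lambda>j. Suc j mod length vs"
  have n0: "0 < ?n" using vs(2) by linarith
  have edgeG: "e \<subseteq> ?V \<and> card e = 2" if "e \<in> edges G" for e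
    using that G by (auto simp: simple_graph_def)
  have FG: "edges (F (c i)) \<subseteq> edges G" "verts (F (c i)) = ?V" if "i < ?n" for i
    using c[OF that] G(2) by (auto simp: spanning_subgraph_def)
  have endV: "end_of vs s \<in> ?V" if "s \<in> ?S" for s
    using two_to_one_end_of[OF vs(1)] vs(2) that by (auto simp: two_to_one_def)
  define M where "M s = {j. j < ?n \<and> {vs ! j, end_of vs s} \<in> edges (F (c (fst s)))}" for s
  have "\<exists>Y\<subseteq>{..<?n}. \<forall>s\<in>?S. k \<le> card {j \<in> M s. j \<in> Y \<and> ?s j \<notin> Y}"
  proof (rule descents_dominate[where D = "2 * max_degree G" and g = g])
    show "?s ` {..<?n} \<subseteq> {..<?n}" using n0 by auto
    show "inj_on ?s {..<?n}" by (rule inj_on_Suc_mod)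
    show "?s j \<noteq> j" if "j \<in> {..<?n}" for j
      using that vs(2) by (auto simp: Suc_mod_eq split: if_splits)
    show "M s \<subseteq> {..<?n}" if "s \<in> ?S" for s by (auto simp: M_def)
    show "3 * (k * g) \<le> card (M s)" if "s \<in> ?S" for s
    proof -
      have i: "fst s < ?n" using that by auto
      have "3 * (k * g) \<le> min_degree (F (c (fst s)))" using deg[OF i] .
      also have "\<dots> \<le> degree (F (c (fst s))) (end_of vs s)"
        using endV[OF that] FG(2)[OF i] by (intro min_degree_le_degree) auto
      also have "\<dots> = card (M s)"
        unfolding M_def by (rule degree_eq_card_positions[OF vs(1)]) (use edgeG FG(1)[OF i] in blast)
      finally show ?thesis .
    qed
    show "card {s \<in> ?S. j \<in> M s} \<le> 2 * max_degree G" if j: "j \<in> {..<?n}" for j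
    proof -
      let ?X = "{e \<in> edges G. vs ! j \<in> e}"
      have "card {s \<in> ?S. j \<in> M s} \<le> card (?X \<times> (UNIV :: bool set))"
      proof (rule card_inj_on_le[of "\<lambda>s. ({vs ! j, end_of vs s}, snd s)"])
        show "inj_on (\<lambda>s. ({vs ! j, end_of vs s}, snd s)) {s \<in> ?S. j \<in> M s}"
        proof (rule inj_onI)
          fix s t assume s: "s \<in> {s \<in> ?S. j \<in> M s}" and t: "t \<in> {s \<in> ?S. j \<in> M s}"
            and eq: "({vs ! j, end_of vs s}, snd s) = ({vs ! j, end_of vs t}, snd t)"
          have "end_of vs s = end_of vs t" using eq by (auto simp: doubleton_eq_iff)
          then have "end_of vs (fst s, snd s) = end_of vs (fst t, snd s)"
            using eq by (cases s; cases t) simp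
          then have "fst s = fst t"
            using inj_onD[OF inj_on_end_of[OF vs(1) n0, of "snd s"], of "fst s" "fst t"] s t by auto
          then show "s = t" using eq by (simp add: prod_eq_iff)
        qed
        show "(\<lambda>s. ({vs ! j, end_of vs s}, snd s)) ` {s \<in> ?S. j \<in> M s} \<subseteq> ?X \<times> UNIV"
          using subsetD[OF FG(1)] by (auto simp: M_def)
        show "finite (?X \<times> (UNIV :: bool set))" using finite_edges[OF G(1)] by simp
      qed
      also have "\<dots> = degree G (vs ! j) * 2" by (simp add: card_cartesian_product degree_def)
      also have "\<dots> \<le> max_degree G * 2"
        using degree_le_max_degree[OF G(1), of "vs ! j"] j G(2) by simp
      finally show ?thesis by simp
    qed
    show "18 * real (2 * max_degree G) * real k * (25 / 27) ^ g \<le> 1" using small by simp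
  qed (use g in auto)
  then obtain Y where Y: "Y \<subseteq> {..<?n}" "\<And>s. s \<in> ?S \<Longrightarrow> k \<le> card {j \<in> M s. j \<in> Y \<and> ?s j \<notin> Y}"
    by blast
  define A where "A = {vs ! j | j. j < ?n \<and> j \<in> Y \<and> ?s j \<notin> Y}"
  have idx: "j \<in> Y \<and> ?s j \<notin> Y" if "j < ?n" "vs ! j \<in> A" for j
    using that nth_eq_iff_index_eq[OF vs(1)] by (auto simp: A_def)
  have dom: "k \<le> card {a \<in> A. {a, end_of vs (i, b)} \<in> edges (F (c i))}" if i: "i < ?n" for i b
  proof -
    have "k \<le> card {j \<in> M (i, b). j \<in> Y \<and> ?s j \<notin> Y}" using Y(2)[of "(i, b)"] i by simp
    also have "\<dots> \<le> card {a \<in> A. {a, end_of vs (i, b)} \<in> edges (F (c i))}"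
    proof (rule card_inj_on_le[of "\<lambda>j. vs ! j"])
      show "inj_on ((!) vs) {j \<in> M (i, b). j \<in> Y \<and> ?s j \<notin> Y}"
        using nth_eq_iff_index_eq[OF vs(1)] by (auto intro!: inj_onI simp: M_def)
      show "finite {a \<in> A. {a, end_of vs (i, b)} \<in> edges (F (c i))}" by (simp add: A_def)
    qed (auto simp: M_def A_def)
    finally show ?thesis .
  qed
  show ?thesis
  proof (rule fact_le_card_rainbow_cycles[OF vs])
    show "A \<subseteq> ?V" by (auto simp: A_def)
    show "A \<noteq> {}" using dom[of 0 False] n0 g(2) by auto
    show "vs ! ?s i \<notin> A" if "i < ?n" "vs ! i \<in> A" for i
      using idx[OF that] idx[of "?s i"] n0 by auto
    show "finite (edges (F (c i)))" if "i < ?n" for i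
      using FG(1)[OF that] finite_edges[OF G(1)] finite_subset by blast
  qed (fact edge dom)+
qed

lemma finite_transversals:
  assumes "simple_graph G"
  shows "finite {p. hamiltonian_transversal G n F p}"
proof (rule finite_subset)
  show "{p. hamiltonian_transversal G n F p} \<subseteq> (SIGMA T:Pow (edges G). T \<rightarrow>\<^sub>E {1..n})"
    by (auto simp: hamiltonian_transversal_def transversal_def PiE_def dest: bij_betwE)
  have "finite T" if "T \<in> Pow (edges G)" for T using that finite_edges[OF assms] finite_subset by auto
  then show "finite (SIGMA T:Pow (edges G). T \<rightarrow>\<^sub>E {1..n})"
    using finite_edges[OF assms] by (intro finite_SigmaI finite_PiE) auto
qed

text \<open>
  A rainbow cycle is sent to its edge set and the inverse of the map from colours to edges.
\<close>

lemma rainbow_cycles_le_transversals: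
  assumes "simple_graph G" and c: "bij_betw c {..<n} {1..n}"
    and F: "\<And>i. i \<in> {1..n} \<Longrightarrow> spanning_subgraph (F i) G"
  shows "card (rainbow_cycles (verts G) n (\<lambda>i. edges (F (c i))))
    \<le> card {p. hamiltonian_transversal G n F p}"
proof (rule card_inj_on_le)
  let ?R = "rainbow_cycles (verts G) n (\<lambda>i. edges (F (c i)))"
  define \<phi> where "\<phi> E = restrict (\<lambda>e. c (the_inv_into {..<n} E e)) (E ` {..<n})" for E :: "nat \<Rightarrow> 'a set"
  have cin: "c i \<in> {1..n}" if "i < n" for i using c that by (auto dest: bij_betwE)
  have R: "inj_on E {..<n}" "hamiltonian_cycle_edges (verts G) (E ` {..<n})"
    "\<And>i. i < n \<Longrightarrow> E i \<in> edges (F (c i))" "E \<in> extensional {..<n}" if "E \<in> ?R" for E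
    using that by (auto simp: rainbow_cycles_def PiE_def)
  have \<phi>: "\<phi> E (E i) = c i" if "E \<in> ?R" "i < n" for E i
    using R(1)[OF that(1)] that(2) by (simp add: \<phi>_def the_inv_into_f_f)
  show "(\<lambda>E. (E ` {..<n}, \<phi> E)) ` ?R \<subseteq> {p. hamiltonian_transversal G n F p}"
  proof (rule image_subsetI)
    fix E assume E: "E \<in> ?R"
    have "bij_betw (c \<circ> the_inv_into {..<n} E) (E ` {..<n}) {1..n}"
      using bij_betw_the_inv_into[OF inj_on_imp_bij_betw[OF R(1)[OF E]]] c by (rule bij_betw_trans)
    then have "bij_betw (\<phi> E) (E ` {..<n}) {1..n}"
      by (rule iffD1[OF bij_betw_cong, rotated]) (simp add: \<phi>_def)
    moreover have "E ` {..<n} \<subseteq> edges G"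
      using R(3)[OF E] F[OF cin] by (auto simp: spanning_subgraph_def)
    moreover have "\<phi> E \<in> extensional (E ` {..<n})" by (simp add: \<phi>_def)
    moreover have "\<forall>e\<in>E ` {..<n}. e \<in> edges (F (\<phi> E e))" using \<phi>[OF E] R(3)[OF E] by auto
    ultimately show "(E ` {..<n}, \<phi> E) \<in> {p. hamiltonian_transversal G n F p}"
      using R(2)[OF E] by (simp add: hamiltonian_transversal_def transversal_def)
  qed
  show "inj_on (\<lambda>E. (E ` {..<n}, \<phi> E)) ?R"
  proof (rule inj_onI)
    fix E E' assume E: "E \<in> ?R" "E' \<in> ?R" and eq: "(E ` {..<n}, \<phi> E) = (E' ` {..<n}, \<phi> E')"
    show "E = E'"
    proof
      fix i show "E i = E' i"
      proof (cases "i < n")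
        case True
        then have "E i \<in> E' ` {..<n}" using eq by blast
        then obtain j where j: "j < n" "E i = E' j" by auto
        then have "c i = c j" using \<phi>[OF E(1) True] \<phi>[OF E(2) j(1)] eq by simp
        then have "i = j" using c True j(1) by (auto simp: bij_betw_def inj_on_def)
        then show ?thesis using j(2) by simp
      next
        case False
        then show ?thesis using R(4)[OF E(1)] R(4)[OF E(2)] by (simp add: extensional_def)
      qed
    qed
  qed
  show "finite {p. hamiltonian_transversal G n F p}" by (rule finite_transversals[OF assms(1)])
qed

text \<open>
  With \<open>x = ln m\<close> the first bound holds as \<open>3 * k * 40 * L\<close> is at most \<open>8 * x\<^sup>2\<close> while
  \<open>sqrt m = exp (x / 2)\<close>. For the second one, the factor 40 in the group size is chosen such that
  \<open>(25 / 27) ^ 40 \<le> 1 / 16\<close>; then \<open>16 ^ L = 4 ^ L * 2 ^ L * 2 ^ L\<close> absorbs \<open>m\<close>, \<open>k\<close> and 36.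
\<close>

lemma group_size_bounds:
  fixes m :: nat
  assumes x: "60 < ln (real m)"
  defines "k \<equiv> nat \<lceil>1 / 60 * ln (real m)\<rceil>" and "L \<equiv> nat \<lceil>ln (real m)\<rceil>"
  shows "real (3 * (k * (40 * L))) \<le> 7 * sqrt (real m * ln (real m))"
    and "36 * real m * real k * (25 / 27) ^ (40 * L) \<le> 1"
proof -
  define x where "x = ln (real m)"
  have x60: "60 < x" using x by (simp add: x_def)
  have m: "0 < real m" using x by (cases "m = 0") auto
  have mx: "real m = exp x" using m by (simp add: x_def)
  have kx: "real k \<le> x / 30" and Lx: "real L \<le> 2 * x" "x \<le> real L"
    using x60 unfolding k_def L_def x_def[symmetric] by linarith+
  have "x\<^sup>2 / 32 \<le> exp (x / 4)"
    using exp_lower_Taylor_quadratic[of "x / 4"] x60 by (simp add: power_divide)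
  then have "(x\<^sup>2 / 32)\<^sup>2 \<le> exp (x / 4) ^ 2" by (intro power_mono) auto
  also have "exp (x / 4) ^ 2 = exp (x / 2)" by (simp flip: exp_of_nat_mult)
  also have "(x\<^sup>2 / 32)\<^sup>2 = (x\<^sup>2 / 1024) * x\<^sup>2" by (simp add: power2_eq_square)
  finally have e: "(x\<^sup>2 / 1024) * x\<^sup>2 \<le> exp (x / 2)" .
  have "60\<^sup>2 \<le> x\<^sup>2" using x60 by (intro power_mono) auto
  then have "2 * x\<^sup>2 \<le> (x\<^sup>2 / 1024) * x\<^sup>2" by (intro mult_right_mono) auto
  then have e2: "2 * x\<^sup>2 \<le> exp (x / 2)" using e by linarith
  have "real k * real L \<le> (x / 30) * (2 * x)" using kx Lx x60 by (intro mult_mono) auto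
  then have "real (3 * (k * (40 * L))) \<le> 8 * x\<^sup>2"
    by (simp add: power2_eq_square mult.commute[of "real L"])
  also have "\<dots> \<le> 7 * exp (x / 2)" using e2 by (smt (verit) zero_le_power2)
  also have "exp (x / 2) = sqrt (real m)"
    using m by (simp add: mx powr_half_sqrt[symmetric] powr_def)
  also have "7 * sqrt (real m) \<le> 7 * sqrt (real m * ln (real m))"
    using m x60 by (simp add: x_def mult_left_le)
  finally show "real (3 * (k * (40 * L))) \<le> 7 * sqrt (real m * ln (real m))" by simp
  have "(25 / 27 :: real) ^ 40 \<le> 1 / 16" by (simp add: power_divide)
  then have "((25 / 27 :: real) ^ 40) ^ L \<le> (1 / 16) ^ L" by (intro power_mono) auto
  then have g: "(25 / 27 :: real) ^ (40 * L) \<le> (1 / 16) ^ L" by (simp only: power_mult)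
  have "real m \<le> exp (real L)" using mx Lx(2) by simp
  also have "\<dots> = exp 1 ^ L" by (simp flip: exp_of_nat_mult)
  also have "\<dots> \<le> 4 ^ L" using exp_le by (intro power_mono) auto
  finally have mL: "real m \<le> 4 ^ L" .
  have "real k \<le> real L" using kx Lx x60 by linarith
  also have "\<dots> \<le> 2 ^ L" using of_nat_less_two_power[of L, where 'a = real] by simp
  finally have kL: "real k \<le> 2 ^ L" .
  have "6 \<le> L" using Lx x60 by linarith
  then have "(2 :: real) ^ 6 \<le> 2 ^ L" by (intro power_increasing) auto
  then have "36 \<le> (2 :: real) ^ L" by simp
  then have "36 * real m * real k \<le> 2 ^ L * 4 ^ L * 2 ^ L"
    using mL kL by (intro mult_mono) auto
  also have "\<dots> = 16 ^ L" by (simp flip: power_mult_distrib)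
  finally have "36 * real m * real k * (25 / 27) ^ (40 * L) \<le> 16 ^ L * (1 / 16) ^ L"
    using g by (intro mult_mono) auto
  then show "36 * real m * real k * (25 / 27) ^ (40 * L) \<le> 1" by (simp add: power_divide)
qed

theorem theorem1p2:
  fixes m n :: nat and G :: "'a sgraph" and F :: "nat \<Rightarrow> 'a sgraph"
  assumes "m \<ge> 262"
    and "simple_graph G" and "card (verts G) = n" and "max_degree G = m"
    and "\<And>i. i \<in> {1..n} \<Longrightarrow> spanning_subgraph (F i) G"
    and "\<And>i. i \<in> {1..n} \<Longrightarrow> real (min_degree (F i)) \<ge> 7 * sqrt (real m * ln (real m))"
    and "\<exists>p. hamiltonian_transversal G n F p"
  shows "card {p. hamiltonian_transversal G n F p} \<ge> fact (nat \<lceil>1 / 60 * ln (real m)\<rceil>)"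
proof -
  let ?T = "{p. hamiltonian_transversal G n F p}"
  define k where "k = nat \<lceil>1 / 60 * ln (real m)\<rceil>"
  define L where "L = nat \<lceil>ln (real m)\<rceil>"
  show ?thesis
  proof (cases "60 < ln (real m)")
    case False
    then have "k = 0 \<or> k = 1" unfolding k_def by linarith
    then have "fact k = (1 :: nat)" by auto
    moreover have "card ?T \<noteq> 0" using assms(7) finite_transversals[OF assms(2)] by auto
    ultimately show ?thesis by (simp add: k_def)
  next
    case True
    note b = group_size_bounds[OF True, folded k_def L_def]
    have pos: "0 < k" "0 < 40 * L" using True unfolding k_def L_def by linarith+
    obtain p where "hamiltonian_transversal G n F p" using assms(7) by blast
    then obtain T \<phi> where T: "hamiltonian_transversal G n F (T, \<phi>)" by (cases p) auto
    then obtain vs where vs: "distinct vs" "set vs = verts G" "length vs \<ge> 3"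
      "T = {{vs ! i, vs ! (Suc i mod length vs)} | i. i < length vs}"
      by (auto simp: hamiltonian_transversal_def hamiltonian_cycle_edges_def)
    have len: "length vs = n" using distinct_card[OF vs(1)] vs(2) assms(3) by simp
    let ?e = "\<lambda>i. {vs ! i, vs ! (Suc i mod length vs)}"
    have Te: "T = ?e ` {..<n}" unfolding vs(4) len setcompr_eq_image lessThan_def ..
    have \<phi>: "bij_betw \<phi> T {1..n}" "\<And>e. e \<in> T \<Longrightarrow> e \<in> edges (F (\<phi> e))"
      using T by (auto simp: hamiltonian_transversal_def transversal_def)
    have "bij_betw ?e {..<n} T"
      using inj_on_cycle_edges[OF vs(1,3)] len by (simp add: bij_betw_def Te)
    then have c: "bij_betw (\<phi> \<circ> ?e) {..<n} {1..n}" using \<phi>(1) by (rule bij_betw_trans)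
    have cin: "(\<phi> \<circ> ?e) i \<in> {1..n}" if "i < length vs" for i
      using bij_betwE[OF c] that len by simp
    have "fact k \<le> card (rainbow_cycles (set vs) (length vs) (\<lambda>i. edges (F ((\<phi> \<circ> ?e) i))))"
    proof (rule rainbow_cycles_of_large_degree[OF vs(1,3) assms(2), where g = "40 * L"])
      fix i assume i: "i < length vs"
      show "spanning_subgraph (F ((\<phi> \<circ> ?e) i)) G" by (rule assms(5)[OF cin[OF i]])
      show "?e i \<in> edges (F ((\<phi> \<circ> ?e) i))" using \<phi>(2)[of "?e i"] i len Te by auto
      have "real (3 * (k * (40 * L))) \<le> real (min_degree (F ((\<phi> \<circ> ?e) i)))"
        using b(1) assms(6)[OF cin[OF i]] by (rule order_trans)
      then show "3 * (k * (40 * L)) \<le> min_degree (F ((\<phi> \<circ> ?e) i))" by (rule of_nat_le_iff[THEN iffD1])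
    qed (use vs(2) pos b(2) assms(4) in auto)
    also have "\<dots> \<le> card ?T"
      unfolding vs(2) len by (rule rainbow_cycles_le_transversals[OF assms(2) c[unfolded len] assms(5)])
    finally show ?thesis by (simp add: k_def)
  qed
qed

end
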